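(* Let $X$ and $Y$ be infinite Tychonoff spaces. Then: (1) $C_p(X\times Y)$ admits a quotient map onto $\mathbb{R}^\omega$ or $(c_0)_p$. (2) $C_k(X\times Y)$ admits a quotient map onto a space isomorphic to one of the following spaces: $\mathbb{R}^\omega$, $(c_0)_p$ or $c_0$.
   Context: For a Tychonoff space $Z$, $C_p(Z)$ and $C_k(Z)$ denote the vector space of all continuous real-valued functions on $Z$ with the pointwise topology and the compact-open topology, respectively. $\mathbb{R}^\omega$ carries the product topology; $(c_0)_p=\{(x_n)_{n\in\omega}\in\mathbb{R}^\omega: x_n\to 0\}$ carries the topology inherited from $\mathbb{R}^\omega$; $c_0$ is the usual Banach space of null sequences with the supremum norm. A quotient map between topological vector spaces is a continuous open linear surjection; isomorphic means linearly homeomorphic. *)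

theory Defs
  imports "HOL-Analysis.Analysis" "HOL-Library.Function_Algebras"
begin

instantiation "fun" :: (type, real_vector) real_vector
begin

definition scaleR_fun :: "real \<Rightarrow> ('a \<Rightarrow> 'b) \<Rightarrow> 'a \<Rightarrow> 'b" where
  "scaleR_fun c f = (\<lambda>x. c *\<^sub>R f x)"

instance
  by standard (simp_all add: scaleR_fun_def fun_eq_iff scaleR_add_right scaleR_add_left)

end

text \<open>
  A topological vector space is given by a topology on a linear subspace of an ambient
  real vector space type; the subspace is the \<^const>\<open>topspace\<close>. No Hausdorff axiom is included.
\<close>

definition topological_vector_space :: "'a::real_vector topology \<Rightarrow> bool" where
  "topological_vector_space E \<longleftrightarrow>
     subspace (topspace E) \<and>
     continuous_map (prod_topology E E) E (\<lambda>(x, y). x + y) \<and>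
     continuous_map (prod_topology euclideanreal E) E (\<lambda>(c, x). c *\<^sub>R x)"

text \<open>
  The predicate \<^const>\<open>linear\<close> concerns maps on whole types; here linearity is required only
  on the carrier, and values outside the carrier are irrelevant.
\<close>

definition linear_between ::
  "'a::real_vector topology \<Rightarrow> 'b::real_vector topology \<Rightarrow> ('a \<Rightarrow> 'b) \<Rightarrow> bool" where
  "linear_between E F T \<longleftrightarrow>
     T \<in> topspace E \<rightarrow> topspace F \<and>
     (\<forall>x\<in>topspace E. \<forall>y\<in>topspace E. T (x + y) = T x + T y) \<and>
     (\<forall>c. \<forall>x\<in>topspace E. T (c *\<^sub>R x) = c *\<^sub>R T x)"

definition tvs_quotient_map ::
  "'a::real_vector topology \<Rightarrow> 'b::real_vector topology \<Rightarrow> ('a \<Rightarrow> 'b) \<Rightarrow> bool" where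
  "tvs_quotient_map E F T \<longleftrightarrow>
     linear_between E F T \<and> continuous_map E F T \<and> open_map E F T \<and>
     T ` topspace E = topspace F"

definition tvs_isomorphic ::
  "'a::real_vector topology \<Rightarrow> 'b::real_vector topology \<Rightarrow> bool" where
  "tvs_isomorphic E F \<longleftrightarrow> (\<exists>T. linear_between E F T \<and> homeomorphic_map E F T)"

definition Tychonoff_space :: "'a topology \<Rightarrow> bool" where
  "Tychonoff_space Z \<longleftrightarrow> completely_regular_space Z \<and> Hausdorff_space Z"

text \<open>
  A function on \<^term>\<open>topspace Z\<close> is represented by its extension by zero to the whole type,
  so that the vector space operations of the function type are the pointwise ones.
\<close>

definition continuous_functions :: "'a topology \<Rightarrow> ('a \<Rightarrow> real) set" where
  "continuous_functions Z =
     {f. continuous_map Z euclideanreal f \<and> (\<forall>x. x \<notin> topspace Z \<longrightarrow> f x = 0)}"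

text \<open>
  Coordinates outside \<^term>\<open>topspace Z\<close> vanish identically on \<^term>\<open>continuous_functions Z\<close>,
  so the subtopology below is the topology of pointwise convergence on \<^term>\<open>topspace Z\<close>.
\<close>

definition Cp :: "'a topology \<Rightarrow> ('a \<Rightarrow> real) topology" where
  "Cp Z = subtopology (powertop_real UNIV) (continuous_functions Z)"

definition Ck :: "'a topology \<Rightarrow> ('a \<Rightarrow> real) topology" where
  "Ck Z = topology_generated_by
     {{f \<in> continuous_functions Z. f ` K \<subseteq> U} | K U. compactin Z K \<and> open U}"

definition R_omega :: "(nat \<Rightarrow> real) topology" where
  "R_omega = powertop_real UNIV"

definition null_sequences :: "(nat \<Rightarrow> real) set" where
  "null_sequences = {x. x \<longlonglongrightarrow> 0}"

definition c0_p :: "(nat \<Rightarrow> real) topology" where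
  "c0_p = subtopology R_omega null_sequences"

text \<open>
  The locale \<^locale>\<open>Metric_space\<close> asks for nonnegativity and symmetry on the whole type, where the
  supremum may be unbounded; hence the default value off the carrier.
\<close>

definition c0_dist :: "(nat \<Rightarrow> real) \<Rightarrow> (nat \<Rightarrow> real) \<Rightarrow> real" where
  "c0_dist x y =
     (if x \<in> null_sequences \<and> y \<in> null_sequences then SUP n. \<bar>x n - y n\<bar> else 0)"

definition c0 :: "(nat \<Rightarrow> real) topology" where
  "c0 = Metric_space.mtopology null_sequences c0_dist"

lemma abs_diff_le_c0_dist:
  assumes "x \<in> null_sequences" "y \<in> null_sequences"
  shows "\<bar>x n - y n\<bar> \<le> c0_dist x y"
proof -
  have "(\<lambda>n. x n - y n) \<longlonglongrightarrow> 0 - 0"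
    using assms unfolding null_sequences_def by (intro tendsto_diff) auto
  then have "Bseq (\<lambda>n. x n - y n)"
    by (intro convergent_imp_Bseq convergentI)
  then obtain B where "\<And>n. \<bar>x n - y n\<bar> \<le> B"
    by (auto simp: Bseq_def)
  then have "bdd_above (range (\<lambda>n. \<bar>x n - y n\<bar>))"
    by (auto intro!: bdd_aboveI)
  then show ?thesis
    using assms by (auto simp: c0_dist_def intro: cSUP_upper)
qed

lemma c0_dist_le:
  assumes "x \<in> null_sequences" "y \<in> null_sequences" "\<And>n. \<bar>x n - y n\<bar> \<le> B"
  shows "c0_dist x y \<le> B"
  using assms by (auto simp: c0_dist_def intro!: cSUP_least)

lemma Metric_space_c0: "Metric_space null_sequences c0_dist"
proof
  fix x y :: "nat \<Rightarrow> real"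
  show "0 \<le> c0_dist x y"
    using abs_diff_le_c0_dist[of x y 0] by (cases "x \<in> null_sequences \<and> y \<in> null_sequences")
      (auto simp: c0_dist_def)
  show "c0_dist x y = c0_dist y x"
    by (simp add: c0_dist_def abs_minus_commute)
next
  fix x y assume xy: "x \<in> null_sequences" "y \<in> null_sequences"
  show "c0_dist x y = 0 \<longleftrightarrow> x = y"
  proof
    assume "c0_dist x y = 0"
    then have "\<bar>x n - y n\<bar> \<le> 0" for n
      using abs_diff_le_c0_dist[OF xy] by metis
    then show "x = y" by (auto simp: fun_eq_iff)
  qed (use xy in \<open>simp add: c0_dist_def\<close>)
next
  fix x y z assume xyz: "x \<in> null_sequences" "y \<in> null_sequences" "z \<in> null_sequences"
  show "c0_dist x z \<le> c0_dist x y + c0_dist y z"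
  proof (rule c0_dist_le[OF xyz(1,3)])
    fix n
    show "\<bar>x n - z n\<bar> \<le> c0_dist x y + c0_dist y z"
      using abs_diff_le_c0_dist[OF xyz(1,2), of n] abs_diff_le_c0_dist[OF xyz(2,3), of n]
      by linarith
  qed
qed

end

(*
  If X * Y is not pseudocompact, an unbounded continuous function yields points z_n with bump
  functions forming a locally finite family, and f |-> (f(z_n)) is a quotient onto R^omega.

  If X * Y is pseudocompact, evaluation at points is replaced by averages mu_n with Rademacher
  signs over finite grids in X * Y. Pseudocompactness makes the sections {f(x,.) : x in X} of a
  continuous f totally bounded in the supremum norm, and for totally bounded families the signs
  cancel, so mu_n(f) -> 0. Disjointly supported bump functions phi_n dual to mu_n give the right
  inverse y |-> sum_n y_n phi_n of f |-> (mu_n(f)). For the compact-open topology, the grids are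
  chosen inside a compact rectangle if both factors contain infinite compact sets, which yields
  c_0; otherwise each compact set meets only finitely many of the supports, which yields (c_0)_p.

  A linear map T with right inverse S is open as soon as each section y |-> u + S(y - T u),
  which passes through u, is continuous.
*)

theory Submission
  imports Defs
begin

section \<open>Sequence spaces and function spaces\<close>

text \<open>Point evaluations cannot serve in the pseudocompact case: an infinite compact space may
  have no nontrivial convergent sequence, and then neither values nor differences of values along
  distinct points need tend to 0. The product supplies what is missing. A grid with N rows and one
  column for each of the 2^N sign vectors carries weights of size 1/(N 2^N). If the rows of f fall,
  up to e, into a number C of classes that does not depend on N, the signs inside one class add up
  to at most sqrt N on average over the columns, against N rows; the weighted average is thus O(e +
  C/sqrt N). The dual functions must stay bounded by 1 although they have exponentially many cells,
  so every cell receives its own bump and the bumps are disjoint. Local finiteness is out of reach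
  here: infinitely many nonzero bumps forming a locally finite family would yield an unbounded
  continuous function. Continuity of the series therefore comes from uniform convergence, which
  needs null coefficients, and the target shrinks from R^omega to null sequences.\<close>

lemma continuous_map_real_iff:
  "continuous_map X euclideanreal f \<longleftrightarrow>
    (\<forall>x\<in>topspace X. \<forall>e>0. \<exists>U. openin X U \<and> x \<in> U \<and> (\<forall>y\<in>U. \<bar>f y - f x\<bar> < e))"
  using Met_TC.continuous_map_to_metric[of X f]
  by (simp add: dist_real_def abs_minus_commute)

lemma subspace_null_sequences: "subspace null_sequences"
  unfolding subspace_def null_sequences_def scaleR_fun_def plus_fun_def zero_fun_def
  by (auto intro: tendsto_add_zero tendsto_mult_right_zero)

lemma topspace_R_omega [simp]: "topspace R_omega = UNIV"
  by (simp add: R_omega_def)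

lemma topspace_c0_p [simp]: "topspace c0_p = null_sequences"
  by (simp add: c0_p_def)

interpretation c0: Metric_space null_sequences c0_dist
  by (rule Metric_space_c0)

lemma topspace_c0 [simp]: "topspace c0 = null_sequences"
  by (simp add: c0_def)

lemma topspace_Cp [simp]: "topspace (Cp Z) = continuous_functions Z"
  by (simp add: Cp_def)

lemma topspace_Ck [simp]: "topspace (Ck Z) = continuous_functions Z"
proof -
  have "continuous_functions Z \<in>
      {{f \<in> continuous_functions Z. f ` K \<subseteq> U} | K U. compactin Z K \<and> open U}"
    by (auto intro!: exI[of _ "{}"])
  then show ?thesis
    unfolding Ck_def topology_generated_by_topspace by blast
qed

lemma continuous_map_R_omega:
  "continuous_map E R_omega f \<longleftrightarrow> (\<forall>n. continuous_map E euclideanreal (\<lambda>x. f x n))"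
  by (simp add: R_omega_def continuous_map_componentwise_UNIV)

lemma continuous_map_c0_p:
  "continuous_map E c0_p f \<longleftrightarrow>
    f \<in> topspace E \<rightarrow> null_sequences \<and> (\<forall>n. continuous_map E euclideanreal (\<lambda>x. f x n))"
  by (auto simp: c0_p_def continuous_map_in_subtopology continuous_map_R_omega)

lemma continuous_map_c0:
  assumes "f \<in> topspace E \<rightarrow> null_sequences"
    and "\<And>x e. x \<in> topspace E \<Longrightarrow> e > 0 \<Longrightarrow>
      \<exists>U. openin E U \<and> x \<in> U \<and> (\<forall>y\<in>U. \<forall>n. \<bar>f x n - f y n\<bar> \<le> e)"
  shows "continuous_map E c0 f"
  unfolding c0_def c0.continuous_map_to_metric
proof (intro ballI allI impI)
  fix x and e :: real
  assume x: "x \<in> topspace E" and e: "e > 0"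
  \<comment> \<open>Halving \<open>e\<close> leaves room for the supremum: coordinatewise bounds
    pass to \<open>c0_dist\<close> only in non-strict form.\<close>
  obtain U where U: "openin E U" "x \<in> U" "\<And>y n. y \<in> U \<Longrightarrow> \<bar>f x n - f y n\<bar> \<le> e / 2"
    using assms(2)[OF x, of "e / 2"] e by auto
  have "f y \<in> c0.mball (f x) e" if "y \<in> U" for y
  proof -
    have "f x \<in> null_sequences" "f y \<in> null_sequences"
      using that assms(1) x openin_subset[OF U(1)] by auto
    moreover from this have "c0_dist (f x) (f y) \<le> e / 2"
      using U(3)[OF that] by (rule c0_dist_le)
    ultimately show ?thesis
      using e by (simp add: c0.in_mball)
  qed
  with U(1,2) show "\<exists>U. openin E U \<and> x \<in> U \<and> (\<forall>y\<in>U. f y \<in> c0.mball (f x) e)"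
    by blast
qed

lemma openin_c0_ball:
  assumes "x \<in> null_sequences" "e > 0"
  shows "\<exists>U. openin c0 U \<and> x \<in> U \<and> (\<forall>y\<in>U. y \<in> null_sequences \<and> (\<forall>n. \<bar>y n - x n\<bar> < e))"
proof -
  have "openin c0 (c0.mball x e)" "x \<in> c0.mball x e"
    using assms by (auto simp: c0_def)
  moreover have "y \<in> null_sequences \<and> (\<forall>n. \<bar>y n - x n\<bar> < e)" if "y \<in> c0.mball x e" for y
    using that abs_diff_le_c0_dist[of x y] assms
    by (auto simp: c0.in_mball abs_minus_commute intro: le_less_trans)
  ultimately show ?thesis by blast
qed

lemma continuous_map_R_omega_coordinate: "continuous_map R_omega euclideanreal (\<lambda>x. x n)"
  unfolding R_omega_def by (rule continuous_map_product_projection) simp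

lemma continuous_map_c0_p_coordinate: "continuous_map c0_p euclideanreal (\<lambda>x. x n)"
  unfolding c0_p_def
  by (rule continuous_map_from_subtopology[OF continuous_map_R_omega_coordinate])

section \<open>Linear topologies on the three target spaces\<close>

lemma tvs_R_omega: "topological_vector_space R_omega"
  unfolding topological_vector_space_def continuous_map_R_omega case_prod_unfold
proof (intro conjI allI)
  fix n
  show "continuous_map (prod_topology R_omega R_omega) euclideanreal (\<lambda>x. (fst x + snd x) n)"
    unfolding plus_fun_apply
    by (intro continuous_intros
        continuous_map_compose[OF continuous_map_fst continuous_map_R_omega_coordinate, unfolded o_def]
        continuous_map_compose[OF continuous_map_snd continuous_map_R_omega_coordinate, unfolded o_def])
  show "continuous_map (prod_topology euclideanreal R_omega) euclideanreal (\<lambda>x. (fst x *\<^sub>R snd x) n)"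
    unfolding scaleR_fun_def real_scaleR_def
    by (intro continuous_intros continuous_map_fst
        continuous_map_compose[OF continuous_map_snd continuous_map_R_omega_coordinate, unfolded o_def])
qed simp

lemma tvs_c0_p: "topological_vector_space c0_p"
  unfolding topological_vector_space_def continuous_map_c0_p case_prod_unfold
proof (intro conjI allI)
  fix n
  show "continuous_map (prod_topology c0_p c0_p) euclideanreal (\<lambda>x. (fst x + snd x) n)"
    unfolding plus_fun_apply
    by (intro continuous_intros
        continuous_map_compose[OF continuous_map_fst continuous_map_c0_p_coordinate, unfolded o_def]
        continuous_map_compose[OF continuous_map_snd continuous_map_c0_p_coordinate, unfolded o_def])
  show "continuous_map (prod_topology euclideanreal c0_p) euclideanreal (\<lambda>x. (fst x *\<^sub>R snd x) n)"
    unfolding scaleR_fun_def real_scaleR_def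
    by (intro continuous_intros continuous_map_fst
        continuous_map_compose[OF continuous_map_snd continuous_map_c0_p_coordinate, unfolded o_def])
qed (use subspace_null_sequences in \<open>auto simp: subspace_add subspace_scale\<close>)

lemma null_sequence_bounded:
  assumes "x \<in> null_sequences"
  obtains B where "B > 0" "\<And>n. \<bar>x n\<bar> \<le> B"
proof -
  have "Bseq x"
    using assms unfolding null_sequences_def by (auto intro: convergent_imp_Bseq convergentI)
  then show thesis
    using that by (auto simp: Bseq_def)
qed

lemma tvs_c0: "topological_vector_space c0"
  unfolding topological_vector_space_def case_prod_unfold
proof (intro conjI continuous_map_c0)
  fix p :: "(nat \<Rightarrow> real) \<times> (nat \<Rightarrow> real)" and e :: real
  assume p: "p \<in> topspace (prod_topology c0 c0)" and e: "e > 0"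
  obtain x y where xy: "p = (x, y)" by (cases p)
  have x: "x \<in> null_sequences" and y: "y \<in> null_sequences"
    using p xy by auto
  from openin_c0_ball[OF x, of "e/2"] e obtain U where U: "openin c0 U" "x \<in> U"
    "\<forall>x'\<in>U. x' \<in> null_sequences \<and> (\<forall>n. \<bar>x' n - x n\<bar> < e / 2)" by auto
  from openin_c0_ball[OF y, of "e/2"] e obtain V where V: "openin c0 V" "y \<in> V"
    "\<forall>y'\<in>V. y' \<in> null_sequences \<and> (\<forall>n. \<bar>y' n - y n\<bar> < e / 2)" by auto
  have "\<bar>(x + y) n - (x' + y') n\<bar> \<le> e" if "x' \<in> U" "y' \<in> V" for x' y' n
    using U(3)[rule_format, OF that(1), THEN conjunct2, rule_format, of n]
      V(3)[rule_format, OF that(2), THEN conjunct2, rule_format, of n]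
    unfolding plus_fun_apply by linarith
  then show "\<exists>U. openin (prod_topology c0 c0) U \<and> p \<in> U \<and>
      (\<forall>q\<in>U. \<forall>n. \<bar>(fst p + snd p) n - (fst q + snd q) n\<bar> \<le> e)"
    using U V xy by (intro exI[of _ "U \<times> V"]) (auto simp: openin_prod_Times_iff)
next
  fix p :: "real \<times> (nat \<Rightarrow> real)" and e :: real
  assume p: "p \<in> topspace (prod_topology euclideanreal c0)" and e: "e > 0"
  obtain a x where ax: "p = (a, x)" by (cases p)
  have x: "x \<in> null_sequences"
    using p ax by auto
  obtain B where B: "B > 0" "\<And>n. \<bar>x n\<bar> \<le> B"
    using null_sequence_bounded[OF x] by blast
  \<comment> \<open>Split a x - b y as (a - b) x - b (y - x). The choice of \<open>d\<close> makes
    the first term at most e/2 via the bound \<open>B\<close> and keeps |b| at most |a| + 1;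
    \<open>r\<close> below then makes the second term at most e/2.\<close>
  define d where "d = min 1 (e / (2 * B))"
  have d: "d > 0" "d \<le> 1" "d * B \<le> e / 2"
    using e B by (auto simp: d_def min_def field_simps)
  define r where "r = e / (2 * (\<bar>a\<bar> + 1))"
  have r: "r > 0" "(\<bar>a\<bar> + 1) * r = e / 2"
    using e unfolding r_def by (auto simp: field_simps)
  from openin_c0_ball[OF x r(1)] obtain V where V: "openin c0 V" "x \<in> V"
    "\<forall>y\<in>V. y \<in> null_sequences \<and> (\<forall>n. \<bar>y n - x n\<bar> < r)" by auto
  have "\<bar>(a *\<^sub>R x) n - (b *\<^sub>R y) n\<bar> \<le> e" if "b \<in> ball a d" "y \<in> V" for b y n
  proof -
    have ab: "\<bar>a - b\<bar> \<le> d" "\<bar>b\<bar> \<le> \<bar>a\<bar> + 1"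
      using that(1) d(2) by (auto simp: dist_real_def)
    have "(a *\<^sub>R x) n - (b *\<^sub>R y) n = (a - b) * x n - b * (y n - x n)"
      by (simp add: scaleR_fun_def algebra_simps)
    also have "\<bar>\<dots>\<bar> \<le> \<bar>a - b\<bar> * \<bar>x n\<bar> + \<bar>b\<bar> * \<bar>y n - x n\<bar>"
      unfolding abs_mult[symmetric] by linarith
    also have "\<dots> \<le> d * B + (\<bar>a\<bar> + 1) * r"
      using ab B d V(3) that(2) by (intro add_mono mult_mono) (auto intro: less_imp_le)
    also have "\<dots> \<le> e" using d r by linarith
    finally show ?thesis .
  qed
  then show "\<exists>U. openin (prod_topology euclideanreal c0) U \<and> p \<in> U \<and>
      (\<forall>q\<in>U. \<forall>n. \<bar>(fst p *\<^sub>R snd p) n - (fst q *\<^sub>R snd q) n\<bar> \<le> e)"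
    using V ax d by (intro exI[of _ "ball a d \<times> V"]) (auto simp: openin_prod_Times_iff)
qed (use subspace_null_sequences in \<open>auto simp: subspace_add subspace_scale\<close>)

lemma tvs_isomorphic_refl: "tvs_isomorphic E E"
  unfolding tvs_isomorphic_def linear_between_def
  by (intro exI[of _ "\<lambda>x. x"]) (auto simp: homeomorphic_map_id[unfolded id_def])

section \<open>Continuity of maps into and out of \<open>Cp\<close> and \<open>Ck\<close>\<close>

lemma subspace_continuous_functions: "subspace (continuous_functions Z)"
  unfolding subspace_def continuous_functions_def plus_fun_def scaleR_fun_def zero_fun_def
  by (auto intro: continuous_map_add continuous_map_real_mult_left)

lemma continuous_map_Cp:
  assumes "f \<in> topspace E \<rightarrow> continuous_functions Z"
    and "\<And>z. z \<in> topspace Z \<Longrightarrow> continuous_map E euclideanreal (\<lambda>x. f x z)"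
  shows "continuous_map E (Cp Z) f"
proof -
  have "continuous_map E euclideanreal (\<lambda>x. f x z)" for z
  proof (cases "z \<in> topspace Z")
    case False
    then have "f x z = 0" if "x \<in> topspace E" for x
      using assms(1) that by (auto simp: continuous_functions_def Pi_iff)
    then show ?thesis
      using continuous_map_eq[OF continuous_map_canonical_const[of E "0::real"]] by simp
  qed (rule assms(2))
  then show ?thesis
    using assms(1) by (auto simp: Cp_def continuous_map_in_subtopology continuous_map_componentwise_UNIV)
qed

lemma continuous_map_Cp_eval: "continuous_map (Cp Z) euclideanreal (\<lambda>f. f z)"
  unfolding Cp_def
  by (intro continuous_map_from_subtopology continuous_map_product_projection) simp

text \<open>
  The tube lemma turns joint continuity on compact pieces into continuity for the
  compact-open topology.
\<close>

lemma continuous_map_Ck: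
  assumes "f \<in> topspace E \<rightarrow> continuous_functions Z"
    and "\<And>K. compactin Z K \<Longrightarrow>
      continuous_map (prod_topology E (subtopology Z K)) euclideanreal (\<lambda>(x, z). f x z)"
  shows "continuous_map E (Ck Z) f"
  unfolding Ck_def continuous_on_generated_topo_iff
proof (intro conjI allI impI)
  have "\<Union> {{f \<in> continuous_functions Z. f ` K \<subseteq> U} |K U. compactin Z K \<and> open U}
      = continuous_functions Z"
    using topspace_Ck[of Z] unfolding Ck_def topology_generated_by_topspace .
  then show "f ` topspace E
      \<subseteq> \<Union> {{f \<in> continuous_functions Z. f ` K \<subseteq> U} |K U. compactin Z K \<and> open U}"
    using assms(1) by auto
next
  fix W assume "W \<in> {{f \<in> continuous_functions Z. f ` K \<subseteq> U} |K U. compactin Z K \<and> open U}"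
  then obtain K U where K: "compactin Z K" and U: "open U"
    and W: "W = {f \<in> continuous_functions Z. f ` K \<subseteq> U}" by blast
  let ?P = "prod_topology E (subtopology Z K)"
  let ?C = "{p \<in> topspace ?P. (case p of (x, z) \<Rightarrow> f x z) \<in> - U}"
  have KZ: "K \<subseteq> topspace Z" using K by (rule compactin_subset_topspace)
  have "closedin ?P ?C"
    using U by (intro closedin_continuous_map_preimage[OF assms(2)[OF K]]) auto
  moreover have "compact_space (subtopology Z K)"
    using K by (simp add: compact_space_subtopology)
  ultimately have "closedin E (fst ` ?C)"
    using closed_map_fst unfolding closed_map_def by blast
  then have "openin E (topspace E - fst ` ?C)" by blast
  moreover have "topspace E - fst ` ?C = f -` W \<inter> topspace E"
    using assms(1) KZ by (force simp: W image_iff)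
  ultimately show "openin E (f -` W \<inter> topspace E)" by simp
qed

lemma openin_Ck:
  assumes "compactin Z K" "open U"
  shows "openin (Ck Z) {f \<in> continuous_functions Z. f ` K \<subseteq> U}"
  unfolding Ck_def using assms by (intro topology_generated_by_Basis) blast

text \<open>A subbasic set confines f to one open set on one compact set, so uniform closeness has
  to be pieced together: K is cut into compact pieces on which f is nearly constant, and g is
  confined near that constant on each piece.\<close>

lemma openin_Ck_ball:
  assumes K: "compactin Z K" and f: "f \<in> continuous_functions Z" and e: "e > 0"
  shows "\<exists>W. openin (Ck Z) W \<and> f \<in> W \<and> (\<forall>g\<in>W. \<forall>z\<in>K. \<bar>g z - f z\<bar> < e)"
proof -
  have fc: "continuous_map Z euclideanreal f"
    using f by (simp add: continuous_functions_def)
  have "compactin euclideanreal (f ` K)"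
    using K fc by (rule image_compactin)
  then have "compact (f ` K)" by simp
  then obtain T where T: "finite T" "f ` K \<subseteq> (\<Union>t\<in>T. ball t (e / 3))"
    using e unfolding compact_eq_totally_bounded by (meson divide_pos_pos zero_less_numeral)
  \<comment> \<open>Closed balls keep the pieces compact. Radius e/3 here against e/2 in
    \<open>W\<close> puts f itself into \<open>W\<close>, and e/3 + e/2 < e closes the
    estimate.\<close>
  define K' where "K' t = K \<inter> {z \<in> topspace Z. f z \<in> cball t (e / 3)}" for t
  have K': "compactin Z (K' t)" for t
    unfolding K'_def using K
    by (intro compact_Int_closedin closedin_continuous_map_preimage[OF fc]) auto
  \<comment> \<open>Intersecting with the carrier matters when \<open>T\<close> is empty: the
    indexed intersection is then the whole type.\<close>
  define W where "W =
    (\<Inter>t\<in>T. {g \<in> continuous_functions Z. g ` K' t \<subseteq> ball t (e / 2)}) \<inter> topspace (Ck Z)"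
  have "openin (Ck Z) W"
    unfolding W_def using T(1) K' by (intro openin_INT openin_Ck open_ball)
  moreover have "f \<in> W"
    using f e by (auto simp: W_def K'_def dist_real_def)
  moreover have "\<bar>g z - f z\<bar> < e" if g: "g \<in> W" and z: "z \<in> K" for g z
  proof -
    obtain t where t: "t \<in> T" "dist t (f z) < e / 3"
      using T z by (auto simp: subset_iff)
    then have "z \<in> K' t"
      using z compactin_subset_topspace[OF K] by (auto simp: K'_def)
    with g t have "dist t (g z) < e / 2"
      by (auto simp: W_def subset_iff)
    with t show ?thesis unfolding dist_real_def by linarith
  qed
  ultimately show ?thesis by blast
qed

lemma continuous_map_Ck_eval:
  assumes "z \<in> topspace Z"
  shows "continuous_map (Ck Z) euclideanreal (\<lambda>f. f z)"
  unfolding continuous_map_real_iff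
proof (intro ballI allI impI)
  fix f and e :: real
  assume "f \<in> topspace (Ck Z)" "e > 0"
  then show "\<exists>U. openin (Ck Z) U \<and> f \<in> U \<and> (\<forall>g\<in>U. \<bar>g z - f z\<bar> < e)"
    using openin_Ck_ball[of Z "{z}" f e] assms by auto
qed

section \<open>Biorthogonal systems\<close>

text \<open>Wherever this is used, only finitely many terms are nonzero at each point, so
  \<open>suminf\<close> is a finite sum and convergence puts no condition on
  \<open>y\<close>.\<close>

definition series :: "(nat \<Rightarrow> 'c \<Rightarrow> real) \<Rightarrow> (nat \<Rightarrow> real) \<Rightarrow> 'c \<Rightarrow> real" where
  "series \<phi> y = (\<lambda>z. \<Sum>n. y n * \<phi> n z)"

lemma series_finite:
  assumes "finite N" "\<And>n. n \<notin> N \<Longrightarrow> \<phi> n z = 0"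
  shows "series \<phi> y z = (\<Sum>n\<in>N. y n * \<phi> n z)"
  unfolding series_def using assms by (intro suminf_finite) auto

lemma series_zero: "series \<phi> 0 = 0"
  by (simp add: series_def fun_eq_iff)

text \<open>Near each point the series is one fixed finite sum, so arbitrary coefficients are
  allowed; this freedom is what makes all of \<open>R_omega\<close> attainable.\<close>

lemma series_locally_finite:
  assumes "\<And>n. \<phi> n \<in> continuous_functions Z"
    and lf: "\<And>z. z \<in> topspace Z \<Longrightarrow>
      \<exists>U N. openin Z U \<and> z \<in> U \<and> finite N \<and> (\<forall>n. n \<notin> N \<longrightarrow> (\<forall>w\<in>U. \<phi> n w = 0))"
  shows "series \<phi> y \<in> continuous_functions Z"
proof -
  have \<phi>: "continuous_map Z euclideanreal (\<phi> n)" "z \<notin> topspace Z \<Longrightarrow> \<phi> n z = 0" for n z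
    using assms(1) by (auto simp: continuous_functions_def)
  have "\<exists>V. openin Z V \<and> z \<in> V \<and> (\<forall>w\<in>V. \<bar>series \<phi> y w - series \<phi> y z\<bar> < e)"
    if z: "z \<in> topspace Z" and e: "e > 0" for z e
  proof -
    obtain U N where U: "openin Z U" "z \<in> U" "finite N" "\<forall>n. n \<notin> N \<longrightarrow> (\<forall>w\<in>U. \<phi> n w = 0)"
      using lf[OF z] by blast
    have eq: "series \<phi> y w = (\<Sum>n\<in>N. y n * \<phi> n w)" if "w \<in> U" for w
      using U that by (intro series_finite) auto
    have "continuous_map Z euclideanreal (\<lambda>w. \<Sum>n\<in>N. y n * \<phi> n w)"
      using \<phi> U by (intro continuous_map_sum continuous_map_real_mult_left)
    then obtain V where V: "openin Z V" "z \<in> V"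
      "\<forall>w\<in>V. \<bar>(\<Sum>n\<in>N. y n * \<phi> n w) - (\<Sum>n\<in>N. y n * \<phi> n z)\<bar> < e"
      unfolding continuous_map_real_iff using z e by blast
    show ?thesis
      using U V eq by (intro exI[of _ "U \<inter> V"]) auto
  qed
  then have "continuous_map Z euclideanreal (series \<phi> y)"
    unfolding continuous_map_real_iff by blast
  moreover have "series \<phi> y z = 0" if "z \<notin> topspace Z" for z
    using \<phi>(2)[OF that] by (simp add: series_def)
  ultimately show ?thesis
    by (simp add: continuous_functions_def)
qed

lemma locally_finite_on_compact:
  assumes "compactin Z K"
    and lf: "\<And>z. z \<in> topspace Z \<Longrightarrow>
      \<exists>U N. openin Z U \<and> z \<in> U \<and> finite N \<and> (\<forall>n. n \<notin> N \<longrightarrow> (\<forall>w\<in>U. \<phi> n w = 0))"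
  shows "\<exists>N. finite N \<and> (\<forall>n. n \<notin> N \<longrightarrow> (\<forall>w\<in>K. \<phi> n w = 0))"
proof -
  obtain U N where UN: "\<And>z. z \<in> topspace Z \<Longrightarrow>
      openin Z (U z) \<and> z \<in> U z \<and> finite (N z) \<and> (\<forall>n. n \<notin> N z \<longrightarrow> (\<forall>w\<in>U z. \<phi> n w = 0))"
    using lf by metis
  have KZ: "K \<subseteq> topspace Z"
    using assms(1) by (rule compactin_subset_topspace)
  have "Ball (U ` K) (openin Z)" "K \<subseteq> \<Union> (U ` K)"
    using UN KZ by auto
  then obtain F where "finite F" "F \<subseteq> U ` K" "K \<subseteq> \<Union> F"
    using assms(1) unfolding compactin_def by blast
  then obtain T where T: "finite T" "T \<subseteq> K" "K \<subseteq> (\<Union>z\<in>T. U z)"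
    by (metis finite_subset_image)
  show ?thesis
  proof (intro exI[of _ "\<Union>z\<in>T. N z"] conjI allI impI ballI)
    show "finite (\<Union>z\<in>T. N z)" using T UN KZ by auto
    fix n w assume n: "n \<notin> (\<Union>z\<in>T. N z)" and w: "w \<in> K"
    then obtain z where "z \<in> T" "w \<in> U z" using T by auto
    with n T KZ UN[of z] show "\<phi> n w = 0" by auto
  qed
qed

text \<open>The finitely supported signed measures with mass \<open>c n k\<close> at
  \<open>pt n k\<close> are dual to the \<open>\<phi> n\<close>. Vanishing off the diagonal is
  required at each support point, so that a series collapses to its n-th term wherever the n-th
  measure looks. One-point index sets give evaluations; larger ones give signed averages.\<close>

locale biorthogonal_system =
  fixes Z :: "'c topology" and \<phi> :: "nat \<Rightarrow> 'c \<Rightarrow> real"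
    and I :: "nat \<Rightarrow> 'k set" and pt :: "nat \<Rightarrow> 'k \<Rightarrow> 'c" and c :: "nat \<Rightarrow> 'k \<Rightarrow> real"
  assumes \<phi>: "\<And>n. \<phi> n \<in> continuous_functions Z"
    and disjoint: "\<And>m n z. \<phi> m z \<noteq> 0 \<Longrightarrow> \<phi> n z \<noteq> 0 \<Longrightarrow> m = n"
    and finite_I: "\<And>n. finite (I n)" and pt: "\<And>n k. k \<in> I n \<Longrightarrow> pt n k \<in> topspace Z"
    and off_diagonal: "\<And>m n k. k \<in> I m \<Longrightarrow> n \<noteq> m \<Longrightarrow> \<phi> n (pt m k) = 0"
    and diagonal: "\<And>n. (\<Sum>k\<in>I n. c n k * \<phi> n (pt n k)) = 1"
begin

text \<open>The index depends on \<open>z\<close> but not on the coefficients: at a fixed point the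
  series reads a single coordinate of \<open>y\<close>.\<close>

lemma series_pointwise:
  "\<exists>k. (\<forall>y. series \<phi> y z = y k * \<phi> k z) \<and> (\<forall>n. n \<noteq> k \<longrightarrow> \<phi> n z = 0)"
proof -
  obtain k where k: "\<And>n. n \<notin> {k} \<Longrightarrow> \<phi> n z = 0"
    using disjoint[of _ z] by (metis insertI1)
  with series_finite[of "{k}" \<phi> z] show ?thesis by auto
qed

definition functional :: "('c \<Rightarrow> real) \<Rightarrow> nat \<Rightarrow> real" where
  "functional f = (\<lambda>n. \<Sum>k\<in>I n. c n k * f (pt n k))"

lemma functional_add: "functional (f + g) = functional f + functional g"
  by (simp add: functional_def fun_eq_iff algebra_simps sum.distrib)

lemma functional_scale: "functional (a *\<^sub>R f) = a *\<^sub>R functional f"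
  by (simp add: functional_def fun_eq_iff scaleR_fun_def sum_distrib_left mult_ac)

lemma functional_series: "functional (series \<phi> y) = y"
proof
  fix n
  have "series \<phi> y (pt n k) = y n * \<phi> n (pt n k)" if "k \<in> I n" for k
    using series_finite[of "{n}" \<phi> "pt n k" y] off_diagonal[OF that] by auto
  then have "functional (series \<phi> y) n = (\<Sum>k\<in>I n. y n * (c n k * \<phi> n (pt n k)))"
    unfolding functional_def by (intro sum.cong) auto
  also have "\<dots> = y n"
    using diagonal[of n] by (simp flip: sum_distrib_left)
  finally show "functional (series \<phi> y) n = y n" .
qed

definition local_section :: "('c \<Rightarrow> real) \<Rightarrow> (nat \<Rightarrow> real) \<Rightarrow> 'c \<Rightarrow> real" where
  "local_section u y = u + series \<phi> (y - functional u)"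

lemma functional_section: "functional (local_section u y) = y"
  by (simp add: local_section_def functional_add functional_series)

lemma section_functional: "local_section u (functional u) = u"
  by (simp add: local_section_def series_zero)

text \<open>The translation by u is built into the section, so openness at u follows without
  appealing to continuity of addition in \<open>E\<close> or \<open>F\<close>: the preimage of an
  open set under the section through u is an open neighbourhood of \<open>functional u\<close>
  inside the image.\<close>

lemma quotient_map_if_sections_continuous:
  assumes E: "topspace E = continuous_functions Z"
    and cont: "continuous_map E F functional"
    and sections: "\<And>u. u \<in> continuous_functions Z \<Longrightarrow> continuous_map F E (local_section u)"
  shows "tvs_quotient_map E F functional"
  unfolding tvs_quotient_map_def linear_between_def
proof (intro conjI ballI allI)
  show maps: "functional \<in> topspace E \<rightarrow> topspace F"
    using cont by (rule continuous_map_funspace)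
  show "functional ` topspace E = topspace F"
  proof
    show "functional ` topspace E \<subseteq> topspace F" using maps by auto
    show "topspace F \<subseteq> functional ` topspace E"
    proof
      fix y assume y: "y \<in> topspace F"
      have "0 \<in> continuous_functions Z"
        using subspace_continuous_functions by (rule subspace_0)
      then have "local_section 0 y \<in> topspace E"
        using sections y continuous_map_funspace by blast
      then show "y \<in> functional ` topspace E"
        using functional_section by (metis imageI)
    qed
  qed
  show "open_map E F functional"
    unfolding open_map_def
  proof (intro allI impI)
    fix W assume W: "openin E W"
    show "openin F (functional ` W)"
    proof (subst openin_subopen, intro ballI)
      fix y assume "y \<in> functional ` W"
      then obtain u where u: "u \<in> W" "y = functional u" by blast
      then have uE: "u \<in> topspace E" using openin_subset[OF W] by blast
      let ?V = "{x \<in> topspace F. local_section u x \<in> W}"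
      have "openin F ?V"
        using uE E W by (intro openin_continuous_map_preimage[OF sections]) auto
      moreover have "y \<in> ?V"
        using u uE maps by (auto simp: section_functional)
      moreover have "?V \<subseteq> functional ` W"
        using functional_section by (auto simp: image_iff) metis
      ultimately show "\<exists>V. openin F V \<and> y \<in> V \<and> V \<subseteq> functional ` W" by blast
    qed
  qed
qed (use cont in \<open>auto simp: functional_add functional_scale\<close>)

lemma continuous_map_functional_coordinate:
  assumes "\<And>z. z \<in> topspace Z \<Longrightarrow> continuous_map E euclideanreal (\<lambda>f. f z)"
  shows "continuous_map E euclideanreal (\<lambda>f. functional f n)"
  unfolding functional_def using finite_I pt
  by (intro continuous_map_sum continuous_map_real_mult_left assms) auto

text \<open>Over K the section is a finite sum of products of a coordinate of y with a function of
  z, hence jointly continuous. This is the input that \<open>continuous_map_Ck\<close> asks for, and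
  it serves every target with continuous coordinates.\<close>

lemma continuous_map_section_on_piece:
  assumes coord: "\<And>n. continuous_map F euclideanreal (\<lambda>y. y n)"
    and u: "u \<in> continuous_functions Z"
    and N: "finite N" "\<And>n z. n \<notin> N \<Longrightarrow> z \<in> K \<Longrightarrow> \<phi> n z = 0"
  shows "continuous_map (prod_topology F (subtopology Z K)) euclideanreal
    (\<lambda>(y, z). local_section u y z)"
proof -
  let ?P = "prod_topology F (subtopology Z K)"
  have snd: "continuous_map ?P euclideanreal (\<lambda>p. f (snd p))"
    if "f \<in> continuous_functions Z" for f
    using that continuous_map_from_subtopology
    by (intro continuous_map_compose[OF continuous_map_snd, unfolded o_def])
      (auto simp: continuous_functions_def)
  have "continuous_map ?P euclideanreal
      (\<lambda>p. u (snd p) + (\<Sum>n\<in>N. (fst p n - functional u n) * \<phi> n (snd p)))"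
    using N(1) u \<phi>
    by (intro continuous_map_add continuous_map_sum continuous_map_real_mult continuous_map_diff snd
        continuous_map_canonical_const
        continuous_map_compose[OF continuous_map_fst coord, unfolded o_def])
  moreover have "u (snd p) + (\<Sum>n\<in>N. (fst p n - functional u n) * \<phi> n (snd p))
      = (case p of (y, z) \<Rightarrow> local_section u y z)" if "p \<in> topspace ?P" for p
    using that N(2)
    by (auto simp: local_section_def series_finite[OF N(1), where \<phi> = \<phi>] split: prod.split)
  ultimately show ?thesis
    by (rule continuous_map_eq)
qed

lemma continuous_map_section_at_point:
  assumes coord: "\<And>n. continuous_map F euclideanreal (\<lambda>y. y n)"
  shows "continuous_map F euclideanreal (\<lambda>y. local_section u y z)"
proof -
  obtain k where k: "\<And>y. series \<phi> y z = y k * \<phi> k z"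
    using series_pointwise[of z] by blast
  show ?thesis
    unfolding local_section_def plus_fun_apply k minus_apply
    by (intro continuous_map_add continuous_map_real_mult continuous_map_diff
        continuous_map_canonical_const coord)
qed

lemma section_in_continuous_functions:
  assumes "u \<in> continuous_functions Z" "series \<phi> (y - functional u) \<in> continuous_functions Z"
  shows "local_section u y \<in> continuous_functions Z"
  unfolding local_section_def using subspace_continuous_functions assms by (rule subspace_add)

lemma quotient_R_omega:
  assumes lf: "\<And>z. z \<in> topspace Z \<Longrightarrow>
      \<exists>U N. openin Z U \<and> z \<in> U \<and> finite N \<and> (\<forall>n. n \<notin> N \<longrightarrow> (\<forall>w\<in>U. \<phi> n w = 0))"
  shows "tvs_quotient_map (Cp Z) R_omega functional" "tvs_quotient_map (Ck Z) R_omega functional"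
proof -
  have sec: "local_section u \<in> topspace R_omega \<rightarrow> continuous_functions Z"
    if "u \<in> continuous_functions Z" for u
    using that \<phi> lf by (auto intro!: section_in_continuous_functions series_locally_finite)
  show "tvs_quotient_map (Cp Z) R_omega functional"
    by (intro quotient_map_if_sections_continuous continuous_map_Cp sec
        continuous_map_section_at_point continuous_map_R_omega_coordinate
        continuous_map_R_omega[THEN iffD2] allI continuous_map_functional_coordinate
        continuous_map_Cp_eval) auto
  show "tvs_quotient_map (Ck Z) R_omega functional"
  proof (intro quotient_map_if_sections_continuous continuous_map_Ck sec
      continuous_map_R_omega[THEN iffD2] allI continuous_map_functional_coordinate
      continuous_map_Ck_eval)
    fix u K assume u: "u \<in> continuous_functions Z" and K: "compactin Z K"
    then obtain N where "finite N" "\<forall>n. n \<notin> N \<longrightarrow> (\<forall>w\<in>K. \<phi> n w = 0)"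
      using locally_finite_on_compact[OF K lf] by blast
    with u show "continuous_map (prod_topology R_omega (subtopology Z K)) euclideanreal
        (\<lambda>(y, z). local_section u y z)"
      by (intro continuous_map_section_on_piece continuous_map_R_omega_coordinate) auto
  qed auto
qed

end

text \<open>A substitute for local finiteness: \<open>functional_null\<close> sends the functional
  into the null sequences, and \<open>bounded\<close> makes the series of a null sequence converge
  uniformly, so the two directions match.\<close>

locale bounded_biorthogonal_system = biorthogonal_system +
  assumes bounded: "\<And>n z. \<bar>\<phi> n z\<bar> \<le> 1"
    and functional_null: "\<And>f. f \<in> continuous_functions Z \<Longrightarrow> functional f \<in> null_sequences"
begin

text \<open>By disjointness the error of a partial sum at z is at most one term, of size at most
  some |y l| with l beyond the cut; the partial sums therefore converge uniformly.\<close>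

lemma series_null_sequence:
  assumes y: "y \<in> null_sequences"
  shows "series \<phi> y \<in> continuous_functions Z"
proof -
  let ?S = "\<lambda>k z. \<Sum>n<k. y n * \<phi> n z"
  have \<phi>c: "continuous_map Z euclideanreal (\<phi> n)" "z \<notin> topspace Z \<Longrightarrow> \<phi> n z = 0" for n z
    using \<phi> by (auto simp: continuous_functions_def)
  have "continuous_map Z Met_TC.mtopology (series \<phi> y)"
  proof (rule Met_TC.continuous_map_uniform_limit)
    show "\<forall>\<^sub>F k in sequentially. continuous_map Z Met_TC.mtopology (?S k)"
      using \<phi>c by (auto intro!: always_eventually continuous_map_sum continuous_map_real_mult_left)
    show "\<not> trivial_limit sequentially" by simp
    fix e :: real assume e: "e > 0"
    have "\<forall>\<^sub>F k in sequentially. \<bar>y k\<bar> < e"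
      using y e unfolding null_sequences_def by (auto simp: tendsto_iff)
    then obtain k0 where k0: "\<And>k. k \<ge> k0 \<Longrightarrow> \<bar>y k\<bar> < e"
      by (auto simp: eventually_sequentially)
    have "dist (?S k z) (series \<phi> y z) < e" if k: "k \<ge> k0" for k z
    proof -
      obtain l where l: "series \<phi> y z = y l * \<phi> l z" "\<And>n. n \<noteq> l \<Longrightarrow> \<phi> n z = 0"
        using series_pointwise[of z] by blast
      have S: "?S k z = (if l < k then y l * \<phi> l z else 0)"
      proof -
        have "?S k z = (\<Sum>n<k. if n = l then y l * \<phi> l z else 0)"
          using l(2) by (intro sum.cong) auto
        then show ?thesis by simp
      qed
      show ?thesis
      proof (cases "l < k")
        case False
        then have "\<bar>y l\<bar> < e" using k0 k by simp
        moreover have "\<bar>y l * \<phi> l z\<bar> \<le> \<bar>y l\<bar>"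
          unfolding abs_mult using bounded[of l z] by (simp add: mult_left_le)
        ultimately show ?thesis using S l(1) False by (simp add: dist_real_def)
      qed (use S l(1) e in simp)
    qed
    then show "\<forall>\<^sub>F k in sequentially. \<forall>z\<in>topspace Z.
        series \<phi> y z \<in> UNIV \<and> dist (?S k z) (series \<phi> y z) < e"
      unfolding eventually_sequentially by blast
  qed
  moreover have "series \<phi> y z = 0" if "z \<notin> topspace Z" for z
    using \<phi>c(2)[OF that] by (simp add: series_def)
  ultimately show ?thesis
    by (simp add: continuous_functions_def)
qed

lemma section_null_sequence:
  assumes "u \<in> continuous_functions Z"
  shows "local_section u \<in> null_sequences \<rightarrow> continuous_functions Z"
  using assms functional_null subspace_null_sequences
  by (auto intro!: section_in_continuous_functions series_null_sequence subspace_diff)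

lemma quotient_Cp_c0_p: "tvs_quotient_map (Cp Z) c0_p functional"
  using functional_null section_null_sequence
  by (intro quotient_map_if_sections_continuous continuous_map_Cp
      continuous_map_section_at_point continuous_map_c0_p_coordinate
      continuous_map_c0_p[THEN iffD2] conjI allI continuous_map_functional_coordinate
      continuous_map_Cp_eval) auto

lemma quotient_Ck_c0_p:
  assumes "\<And>K. compactin Z K \<Longrightarrow> \<exists>N. finite N \<and> (\<forall>n. n \<notin> N \<longrightarrow> (\<forall>w\<in>K. \<phi> n w = 0))"
  shows "tvs_quotient_map (Ck Z) c0_p functional"
proof (intro quotient_map_if_sections_continuous continuous_map_Ck
      continuous_map_c0_p[THEN iffD2] conjI allI continuous_map_functional_coordinate
      continuous_map_Ck_eval)
  fix u K assume u: "u \<in> continuous_functions Z" and K: "compactin Z K"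
  then obtain N where "finite N" "\<forall>n. n \<notin> N \<longrightarrow> (\<forall>w\<in>K. \<phi> n w = 0)"
    using assms by blast
  with u show "continuous_map (prod_topology c0_p (subtopology Z K)) euclideanreal
      (\<lambda>(y, z). local_section u y z)"
    by (intro continuous_map_section_on_piece continuous_map_c0_p_coordinate) auto
qed (use functional_null section_null_sequence in auto)

text \<open>All measures live on one compact K and have total mass at most 1, so every coordinate of
  the functional is dominated by the same seminorm, the supremum over K. This uniformity in n is
  what the norm topology of \<open>c0\<close> demands.\<close>

lemma quotient_Ck_c0:
  assumes K: "compactin Z K" "\<And>n k. k \<in> I n \<Longrightarrow> pt n k \<in> K"
    and c: "\<And>n. (\<Sum>k\<in>I n. \<bar>c n k\<bar>) \<le> 1"
  shows "tvs_quotient_map (Ck Z) c0 functional"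
proof (intro quotient_map_if_sections_continuous continuous_map_Ck continuous_map_c0)
  fix f and e :: real assume f: "f \<in> topspace (Ck Z)" and e: "e > 0"
  obtain W where W: "openin (Ck Z) W" "f \<in> W" "\<forall>g\<in>W. \<forall>z\<in>K. \<bar>g z - f z\<bar> < e"
    by (rule openin_Ck_ball[OF K(1) f[unfolded topspace_Ck] e, THEN exE]) (elim conjE)
  have "\<bar>functional f n - functional g n\<bar> \<le> e" if "g \<in> W" for g n
  proof -
    have "\<bar>functional f n - functional g n\<bar> = \<bar>\<Sum>k\<in>I n. c n k * (f (pt n k) - g (pt n k))\<bar>"
      by (simp add: functional_def right_diff_distrib sum_subtractf)
    also have "\<dots> \<le> (\<Sum>k\<in>I n. \<bar>c n k * (f (pt n k) - g (pt n k))\<bar>)"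
      by (rule sum_abs)
    also have "\<dots> \<le> (\<Sum>k\<in>I n. \<bar>c n k\<bar> * e)"
    proof (rule sum_mono)
      fix k assume "k \<in> I n"
      then have "\<bar>g (pt n k) - f (pt n k)\<bar> < e" using W(3) that K(2)[of k n] by blast
      then show "\<bar>c n k * (f (pt n k) - g (pt n k))\<bar> \<le> \<bar>c n k\<bar> * e"
        unfolding abs_mult by (intro mult_left_mono) linarith+
    qed
    also have "\<dots> \<le> e"
      using c[of n] e by (simp flip: sum_distrib_right)
    finally show ?thesis .
  qed
  with W(1,2) show "\<exists>U. openin (Ck Z) U \<and> f \<in> U \<and>
      (\<forall>g\<in>U. \<forall>n. \<bar>functional f n - functional g n\<bar> \<le> e)"
    by (intro exI[of _ W]) simp
next
  fix u K assume u: "u \<in> continuous_functions Z"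
  let ?P = "prod_topology c0 (subtopology Z K)"
  show "continuous_map ?P euclideanreal (\<lambda>(y, z). local_section u y z)"
    unfolding continuous_map_real_iff
  proof (intro ballI allI impI)
    fix p and e :: real assume p: "p \<in> topspace ?P" and e: "e > 0"
    obtain y z where yz: "p = (y, z)" by (cases p)
    have y: "y \<in> null_sequences" and z: "z \<in> topspace Z" "z \<in> K" using p yz by auto
    have "continuous_map Z euclideanreal (local_section u y)"
      using section_null_sequence[OF u] y by (auto simp: continuous_functions_def)
    then obtain V where V: "openin Z V" "z \<in> V"
      "\<forall>w\<in>V. \<bar>local_section u y w - local_section u y z\<bar> < e / 2"
      unfolding continuous_map_real_iff using z(1) half_gt_zero[OF e] by meson
    obtain W where W: "openin c0 W" "y \<in> W"
      "\<forall>x\<in>W. x \<in> null_sequences \<and> (\<forall>n. \<bar>x n - y n\<bar> < e / 2)"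
      using openin_c0_ball[OF y, of "e / 2"] e by auto
    \<comment> \<open>Changing the coefficients costs at most the supremum distance, whatever w is;
      changing the point uses the continuity of the single function
      \<open>local_section u y\<close>.\<close>
    have "\<bar>local_section u x w - local_section u y z\<bar> < e" if "x \<in> W" "w \<in> V" for x w
    proof -
      obtain k where "\<And>y. series \<phi> y w = y k * \<phi> k w"
        using series_pointwise[of w] by blast
      then have "local_section u x w - local_section u y w = (x k - y k) * \<phi> k w"
        by (simp add: local_section_def algebra_simps)
      also have "\<bar>\<dots>\<bar> \<le> \<bar>x k - y k\<bar>"
        unfolding abs_mult using bounded[of k w] by (simp add: mult_left_le)
      also have "\<dots> < e / 2" using W that by blast
      finally have "\<bar>local_section u x w - local_section u y w\<bar> < e / 2" .
      moreover have "\<bar>local_section u y w - local_section u y z\<bar> < e / 2"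
        using V that by blast
      ultimately show ?thesis by linarith
    qed
    moreover have "openin (subtopology Z K) (K \<inter> V)"
      using V(1) by (rule openin_subtopology_Int2)
    ultimately show "\<exists>U. openin ?P U \<and> p \<in> U \<and> (\<forall>q\<in>U.
        \<bar>(case q of (y, z) \<Rightarrow> local_section u y z) - (case p of (y, z) \<Rightarrow> local_section u y z)\<bar> < e)"
      using V W yz z by (intro exI[of _ "W \<times> (K \<inter> V)"]) (auto simp: openin_prod_Times_iff)
  qed
qed (use functional_null section_null_sequence in auto)

end

section \<open>Pseudocompact products\<close>

lemma completely_regular_bump:
  assumes "completely_regular_space Z" "openin Z U" "x \<in> U"
  shows "\<exists>f\<in>continuous_functions Z. f x = 1 \<and> (\<forall>z. 0 \<le> f z \<and> f z \<le> 1) \<and> (\<forall>z. z \<notin> U \<longrightarrow> f z = 0)"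
proof -
  have UZ: "U \<subseteq> topspace Z" using assms(2) by (rule openin_subset)
  have "closedin Z (topspace Z - U)" "x \<in> topspace Z - (topspace Z - U)"
    using assms UZ by auto
  then obtain g :: "_ \<Rightarrow> real" where g: "continuous_map Z (top_of_set {0..1}) g" "g x = 0"
    "g ` (topspace Z - U) \<subseteq> {1}"
    using assms(1) unfolding completely_regular_space_def by meson
  have gc: "continuous_map Z euclideanreal g" and g01: "\<And>z. z \<in> topspace Z \<Longrightarrow> g z \<in> {0..1}"
    using g(1) by (auto simp: continuous_map_in_subtopology)
  let ?f = "\<lambda>z. if z \<in> topspace Z then 1 - g z else 0"
  have "continuous_map Z euclideanreal (\<lambda>z. 1 - g z)"
    using gc by (intro continuous_map_diff continuous_map_canonical_const)
  then have "continuous_map Z euclideanreal ?f"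
    by (rule continuous_map_eq) auto
  then show ?thesis
    using assms(3) UZ g g01 by (intro bexI[of _ ?f]) (auto simp: continuous_functions_def)
qed

section \<open>Pseudocompactness: its failure gives \<open>R_omega\<close>, its presence gives
  cluster points\<close>

definition pseudocompact_space :: "'c topology \<Rightarrow> bool" where
  "pseudocompact_space Z \<longleftrightarrow>
    (\<forall>f. continuous_map Z euclideanreal f \<longrightarrow> (\<exists>B. \<forall>z\<in>topspace Z. \<bar>f z\<bar> \<le> B))"

lemma not_pseudocompact_quotient_R_omega:
  assumes "\<not> pseudocompact_space Z"
  shows "\<exists>T. tvs_quotient_map (Cp Z) R_omega T \<and> tvs_quotient_map (Ck Z) R_omega T"
proof -
  obtain f where f: "continuous_map Z euclideanreal f" "\<And>B. \<exists>z\<in>topspace Z. \<bar>f z\<bar> > B"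
    using assms unfolding pseudocompact_space_def by (metis not_le)
  define g where "g z = \<bar>f z\<bar>" for z
  have g: "continuous_map Z euclideanreal g"
    using f(1) unfolding g_def by (rule continuous_map_real_abs)
  obtain pk where pk: "\<And>B. pk B \<in> topspace Z \<and> g (pk B) > B"
    using f(2) unfolding g_def by metis
  \<comment> \<open>Each new point is taken more than 1 higher than the last, where
    \<open>g z\<close> is the height of z.\<close>
  define p where "p = rec_nat (pk 0) (\<lambda>_ z. pk (g z + 1))"
  have p: "p n \<in> topspace Z" for n
    by (cases n) (auto simp: p_def pk)
  have step: "g (p (Suc n)) > g (p n) + 1" for n
    using pk by (simp add: p_def)
  have gap: "g (p n) \<ge> g (p m) + real (n - m)" if "m \<le> n" for m n
    using that
  proof (induction n rule: dec_induct)
    case (step n)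
    then show ?case using \<open>g (p (Suc n)) > g (p n) + 1\<close> by (simp add: Suc_diff_le)
  qed simp
  \<comment> \<open>A tent in the height, of half-width 1/2: heights at least 1 apart give disjoint
    tents.\<close>
  define \<phi> where "\<phi> n z = (if z \<in> topspace Z then max 0 (1 - 2 * \<bar>g z - g (p n)\<bar>) else 0)" for n z
  have near: "\<bar>g z - g (p n)\<bar> < 1 / 2" if "\<phi> n z \<noteq> 0" for n z
    using that by (auto simp: \<phi>_def max_def split: if_splits)
  have apart: "m = n" if "\<bar>g (p m) - g (p n)\<bar> < 1" for m n
  proof (rule ccontr)
    assume "m \<noteq> n"
    then consider "m < n" | "n < m" by linarith
    then show False
      by cases (use gap[of m n] gap[of n m] that in auto)
  qed
  have \<phi>C: "\<phi> n \<in> continuous_functions Z" for n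
  proof -
    have "continuous_map Z euclideanreal (\<lambda>z. max 0 (1 - 2 * \<bar>g z - g (p n)\<bar>))"
      by (intro continuous_map_real_max continuous_map_diff continuous_map_real_mult_left
          continuous_map_real_abs continuous_map_canonical_const g)
    then have "continuous_map Z euclideanreal (\<phi> n)"
      by (rule continuous_map_eq) (simp add: \<phi>_def)
    then show ?thesis by (simp add: continuous_functions_def \<phi>_def)
  qed
  interpret biorthogonal_system Z \<phi> "\<lambda>_. {()}" "\<lambda>n _. p n" "\<lambda>_ _. 1"
  proof
    show "m = n" if "\<phi> m z \<noteq> 0" "\<phi> n z \<noteq> 0" for m n z
      using near[OF that(1)] near[OF that(2)] by (intro apart) linarith
    show "\<phi> n (p m) = 0" if "n \<noteq> m" for m n
      using near[of n "p m"] apart[of m n] that by fastforce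
    show "(\<Sum>k\<in>{()}. 1 * \<phi> n (p n)) = 1" for n
      using p by (simp add: \<phi>_def)
  qed (use \<phi>C p in auto)
  have lf: "\<exists>U N. openin Z U \<and> z \<in> U \<and> finite N \<and> (\<forall>n. n \<notin> N \<longrightarrow> (\<forall>w\<in>U. \<phi> n w = 0))"
    if z: "z \<in> topspace Z" for z
  proof (intro exI conjI allI impI ballI)
    \<comment> \<open>On \<open>?U\<close> heights stay below g z + 1, so only tents centred below g
      z + 2 can reach it. There are finitely many, as g (p n) is at least n.\<close>
    let ?U = "{w \<in> topspace Z. g w \<in> {..<g z + 1}}"
    let ?N = "{n. g (p n) < g z + 2}"
    show "openin Z ?U"
      by (rule openin_continuous_map_preimage[OF g]) simp
    show "z \<in> ?U" using z by simp
    have "n \<le> nat \<lceil>g z + 2\<rceil>" if "n \<in> ?N" for n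
    proof -
      have "real n < g z + 2" using that gap[of 0 n] by (simp add: g_def)
      then show ?thesis by linarith
    qed
    then have "?N \<subseteq> {..nat \<lceil>g z + 2\<rceil>}" by blast
    then show "finite ?N" by (rule finite_subset) simp
    show "\<phi> n w = 0" if "n \<notin> ?N" "w \<in> ?U" for n w
    proof (rule ccontr)
      assume "\<phi> n w \<noteq> 0"
      then have "\<bar>g w - g (p n)\<bar> < 1 / 2" by (rule near)
      moreover have "g w < g z + 1" "g (p n) \<ge> g z + 2" using that by auto
      ultimately show False by linarith
    qed
  qed
  show ?thesis
    using quotient_R_omega[OF lf] by blast
qed

text \<open>Without a cluster point, bumps supported in the \<open>W n\<close> form a locally finite
  family, and the sum of n times the n-th bump is continuous and unbounded.\<close>

lemma pseudocompact_cluster_point: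
  assumes Z: "completely_regular_space Z" "pseudocompact_space Z"
    and W: "\<And>n. openin Z (W n)" "\<And>n. W n \<noteq> {}"
  shows "\<exists>z\<in>topspace Z. \<forall>U. openin Z U \<and> z \<in> U \<longrightarrow> infinite {n::nat. U \<inter> W n \<noteq> {}}"
proof (rule ccontr)
  assume "\<not> ?thesis"
  then have lf: "\<exists>U. openin Z U \<and> z \<in> U \<and> finite {n. U \<inter> W n \<noteq> {}}" if "z \<in> topspace Z" for z
    using that by blast
  obtain w where w: "\<And>n. w n \<in> W n"
    using W(2) unfolding ex_in_conv[symmetric] by metis
  have "\<exists>f. f \<in> continuous_functions Z \<and> f (w n) = 1 \<and> (\<forall>z. 0 \<le> f z \<and> f z \<le> 1) \<and>
      (\<forall>z. z \<notin> W n \<longrightarrow> f z = 0)" for n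
    using completely_regular_bump[OF Z(1) W(1) w] by blast
  then obtain \<phi> where \<phi>: "\<And>n. \<phi> n \<in> continuous_functions Z" "\<And>n. \<phi> n (w n) = 1"
    "\<And>n z. 0 \<le> \<phi> n z" "\<And>n z. z \<notin> W n \<Longrightarrow> \<phi> n z = 0"
    by metis
  have lf': "\<exists>U N. openin Z U \<and> z \<in> U \<and> finite N \<and> (\<forall>n. n \<notin> N \<longrightarrow> (\<forall>w\<in>U. \<phi> n w = 0))"
    if z: "z \<in> topspace Z" for z
  proof -
    obtain U where "openin Z U" "z \<in> U" "finite {n. U \<inter> W n \<noteq> {}}"
      using lf[OF z] by blast
    then show ?thesis
      using \<phi>(4) by (intro exI[of _ U] exI[of _ "{n. U \<inter> W n \<noteq> {}}"]) blast
  qed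
  have "series \<phi> real \<in> continuous_functions Z"
    using \<phi>(1) lf' by (rule series_locally_finite)
  then obtain B where B: "\<And>z. z \<in> topspace Z \<Longrightarrow> \<bar>series \<phi> real z\<bar> \<le> B"
    using Z(2) unfolding pseudocompact_space_def continuous_functions_def by blast
  have "real n \<le> B" for n
  proof -
    have wn: "w n \<in> topspace Z"
      using w[of n] openin_subset[OF W(1)] by blast
    then obtain U N where N: "finite N" "\<And>k. k \<notin> N \<Longrightarrow> \<phi> k (w n) = 0"
      using lf' by meson
    have "n \<in> N" using N(2)[of n] \<phi>(2)[of n] by auto
    \<comment> \<open>The \<open>W n\<close> may overlap, so other bumps can be nonzero at
      \<open>w n\<close>; nonnegativity lets the n-th term alone bound the sum from below.\<close>
    then have "real n * \<phi> n (w n) \<le> (\<Sum>k\<in>N. real k * \<phi> k (w n))"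
      using N(1) \<phi>(3) by (intro member_le_sum) auto
    also have "\<dots> = series \<phi> real (w n)"
      using N by (rule series_finite[symmetric])
    also have "\<dots> \<le> B" using B[OF wn] by linarith
    finally show ?thesis using \<phi>(2) by simp
  qed
  then show False
    using reals_Archimedean2[of B] by (meson not_le)
qed

lemma pseudocompact_prod_cluster_point:
  assumes Z: "completely_regular_space (prod_topology X Y)" "pseudocompact_space (prod_topology X Y)"
    and U: "\<And>n. openin X (U n)" "\<And>n. U n \<noteq> {}" and V: "\<And>n. openin Y (V n)" "\<And>n. V n \<noteq> {}"
  obtains x y where "x \<in> topspace X" "y \<in> topspace Y"
    "\<And>G H. openin X G \<Longrightarrow> x \<in> G \<Longrightarrow> openin Y H \<Longrightarrow> y \<in> H \<Longrightarrow>
      infinite {n::nat. G \<inter> U n \<noteq> {} \<and> H \<inter> V n \<noteq> {}}"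
proof -
  have "openin (prod_topology X Y) (U n \<times> V n)" "U n \<times> V n \<noteq> {}" for n
    using U V by (auto simp: openin_prod_Times_iff)
  then have "\<exists>z\<in>topspace (prod_topology X Y). \<forall>G. openin (prod_topology X Y) G \<and> z \<in> G \<longrightarrow>
      infinite {n. G \<inter> (U n \<times> V n) \<noteq> {}}"
    by (intro pseudocompact_cluster_point Z)
  then obtain x y where xy: "x \<in> topspace X" "y \<in> topspace Y"
    and cl: "\<And>G. openin (prod_topology X Y) G \<Longrightarrow> (x, y) \<in> G \<Longrightarrow> infinite {n. G \<inter> (U n \<times> V n) \<noteq> {}}"
    by auto
  have "infinite {n. G \<inter> U n \<noteq> {} \<and> H \<inter> V n \<noteq> {}}"
    if "openin X G" "x \<in> G" "openin Y H" "y \<in> H" for G H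
    using cl[of "G \<times> H"] that by (simp add: openin_prod_Times_iff Times_Int_Times Times_empty)
  with xy that show thesis by blast
qed

section \<open>Equicontinuity and total boundedness of sections\<close>

lemma continuous_map_prod_box:
  assumes "continuous_map (prod_topology X Y) euclideanreal f"
    and "x \<in> topspace X" "y \<in> topspace Y" "e > 0"
  obtains U V where "openin X U" "x \<in> U" "openin Y V" "y \<in> V"
    "\<And>a b. a \<in> U \<Longrightarrow> b \<in> V \<Longrightarrow> \<bar>f (a, b) - f (x, y)\<bar> < e"
proof -
  have "(x, y) \<in> topspace (prod_topology X Y)" using assms by simp
  then obtain O' where O': "openin (prod_topology X Y) O'" "(x, y) \<in> O'"
    "\<forall>p\<in>O'. \<bar>f p - f (x, y)\<bar> < e"
    using assms(1,4) unfolding continuous_map_real_iff by meson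
  then obtain U V where "openin X U" "openin Y V" "x \<in> U" "y \<in> V" "U \<times> V \<subseteq> O'"
    unfolding openin_prod_topology_alt by meson
  with O'(3) that show thesis by blast
qed

text \<open>
  If this fails, one finds boxes \<open>U\<^sub>n \<times> V\<^sub>n\<close> such that \<open>f(\<cdot>, b)\<close> differs by more than \<open>e/2\<close>
  between \<open>U\<^sub>n\<close> and all later \<open>U\<^sub>m\<close>, for \<open>b \<in> V\<^sub>n\<close>; this contradicts continuity at a cluster
  point of the boxes.
\<close>

lemma pseudocompact_prod_equicontinuous:
  assumes Z: "completely_regular_space (prod_topology X Y)" "pseudocompact_space (prod_topology X Y)"
    and f: "continuous_map (prod_topology X Y) euclideanreal f"
    and x0: "x0 \<in> topspace X" and e: "e > 0"
  shows "\<exists>W. openin X W \<and> x0 \<in> W \<and> (\<forall>x\<in>W. \<forall>y\<in>topspace Y. \<bar>f (x, y) - f (x0, y)\<bar> \<le> e)"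
proof (rule ccontr)
  assume neg: "\<not> ?thesis"
  have e4: "e / 4 > 0" using e by simp
  have step: "\<exists>U V W'. openin X U \<and> U \<noteq> {} \<and> U \<subseteq> W \<and> openin Y V \<and> V \<noteq> {} \<and>
      openin X W' \<and> x0 \<in> W' \<and> W' \<subseteq> W \<and>
      (\<forall>a\<in>U. \<forall>b\<in>V. \<forall>a'\<in>W'. \<bar>f (a, b) - f (a', b)\<bar> > e / 2)"
    if W: "openin X W" "x0 \<in> W" for W
  proof -
    obtain x y where xy: "x \<in> W" "y \<in> topspace Y" "\<bar>f (x, y) - f (x0, y)\<bar> > e"
      using neg W by (meson not_le)
    have x: "x \<in> topspace X" using xy(1) openin_subset[OF W(1)] by blast
    obtain U1 V1 where 1: "openin X U1" "x \<in> U1" "openin Y V1" "y \<in> V1"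
      "\<And>a b. a \<in> U1 \<Longrightarrow> b \<in> V1 \<Longrightarrow> \<bar>f (a, b) - f (x, y)\<bar> < e / 4"
      using continuous_map_prod_box[OF f x xy(2) e4] by metis
    obtain U2 V2 where 2: "openin X U2" "x0 \<in> U2" "openin Y V2" "y \<in> V2"
      "\<And>a b. a \<in> U2 \<Longrightarrow> b \<in> V2 \<Longrightarrow> \<bar>f (a, b) - f (x0, y)\<bar> < e / 4"
      using continuous_map_prod_box[OF f x0 xy(2) e4] by metis
    \<comment> \<open>Variation below e/4 around (x, y) and around (x0, y) reduces the gap e to no
      less than e - 2 (e/4).\<close>
    have "\<bar>f (a, b) - f (a', b)\<bar> > e / 2"
      if "a \<in> U1 \<inter> W" "b \<in> V1 \<inter> V2" "a' \<in> U2 \<inter> W" for a b a'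
      using 1(5)[of a b] 2(5)[of a' b] xy(3) that by (simp add: field_simps) argo
    moreover have "openin X (U1 \<inter> W)" "openin Y (V1 \<inter> V2)" "openin X (U2 \<inter> W)"
      using 1 2 W by auto
    moreover have "x \<in> U1 \<inter> W" "y \<in> V1 \<inter> V2" "x0 \<in> U2 \<inter> W"
      using 1 2 W xy by auto
    ultimately show ?thesis
      by (intro exI[of _ "U1 \<inter> W"] exI[of _ "V1 \<inter> V2"] exI[of _ "U2 \<inter> W"]) blast
  qed
  obtain u v w where uvw: "\<And>W. openin X W \<Longrightarrow> x0 \<in> W \<Longrightarrow>
      openin X (u W) \<and> u W \<noteq> {} \<and> u W \<subseteq> W \<and> openin Y (v W) \<and> v W \<noteq> {} \<and>
      openin X (w W) \<and> x0 \<in> w W \<and> w W \<subseteq> W \<and>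
      (\<forall>a\<in>u W. \<forall>b\<in>v W. \<forall>a'\<in>w W. \<bar>f (a, b) - f (a', b)\<bar> > e / 2)"
    using step by metis
  define W where "W n = (w ^^ n) (topspace X)" for n
  have W: "openin X (W n) \<and> x0 \<in> W n" for n
    by (induction n) (use uvw x0 in \<open>auto simp: W_def\<close>)
  have Wn: "openin X (u (W n))" "u (W n) \<noteq> {}" "u (W n) \<subseteq> W n" "openin Y (v (W n))" "v (W n) \<noteq> {}"
    "W (Suc n) \<subseteq> W n"
    "\<And>a b a'. a \<in> u (W n) \<Longrightarrow> b \<in> v (W n) \<Longrightarrow> a' \<in> W (Suc n) \<Longrightarrow> \<bar>f (a, b) - f (a', b)\<bar> > e / 2"
    for n
    using uvw[of "W n"] W[of n] by (auto simp: W_def)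
  have anti: "u (W m) \<subseteq> W (Suc n)" if "n < m" for m n
    using lift_Suc_antimono_le[of W "Suc n" m] Wn(6) Wn(3)[of m] that by auto
  obtain x y where xy: "x \<in> topspace X" "y \<in> topspace Y"
    and cl: "\<And>G H. openin X G \<Longrightarrow> x \<in> G \<Longrightarrow> openin Y H \<Longrightarrow> y \<in> H \<Longrightarrow>
      infinite {n. G \<inter> u (W n) \<noteq> {} \<and> H \<inter> v (W n) \<noteq> {}}"
    by (rule pseudocompact_prod_cluster_point
        [OF Z, of "\<lambda>n. u (W n)" "\<lambda>n. v (W n)", OF Wn(1,2,4,5)]) (rule that)
  obtain G H where GH: "openin X G" "x \<in> G" "openin Y H" "y \<in> H"
    "\<And>a b. a \<in> G \<Longrightarrow> b \<in> H \<Longrightarrow> \<bar>f (a, b) - f (x, y)\<bar> < e / 4"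
    using continuous_map_prod_box[OF f xy e4] by metis
  have inf: "infinite {n. G \<inter> u (W n) \<noteq> {} \<and> H \<inter> v (W n) \<noteq> {}}"
    using GH by (intro cl)
  then obtain n where n: "G \<inter> u (W n) \<noteq> {}" "H \<inter> v (W n) \<noteq> {}"
    using infinite_imp_nonempty by blast
  \<comment> \<open>Only the first coordinate is taken from a later box: \<open>anti\<close> puts
    \<open>u (W m)\<close> inside \<open>W (Suc n)\<close>, where the gap over
    \<open>v (W n)\<close> still holds. Variation below e/4 on G and H caps the same difference by
    e/2.\<close>
  obtain m where m: "n < m" "G \<inter> u (W m) \<noteq> {}"
    using inf unfolding infinite_nat_iff_unbounded by blast
  obtain a b where ab: "a \<in> G" "b \<in> H" "a \<in> u (W n)" "b \<in> v (W n)" using n by blast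
  obtain a' where a': "a' \<in> G" "a' \<in> u (W m)" using m by blast
  have "\<bar>f (a, b) - f (a', b)\<bar> > e / 2"
    using ab a' anti[OF m(1)] by (intro Wn(7)) auto
  with GH(5)[OF ab(1,2)] GH(5)[OF a'(1) ab(2)] show False
    by linarith
qed

text \<open>Otherwise a greedy choice yields points whose sections are pairwise more than e apart.
  Equicontinuity gives each a neighbourhood of variation e/4; around a cluster point of these
  neighbourhoods lies another such neighbourhood, which meets two of them, and four steps of e/4
  join two separated sections.\<close>

lemma pseudocompact_prod_totally_bounded:
  assumes Z: "completely_regular_space (prod_topology X Y)" "pseudocompact_space (prod_topology X Y)"
    and f: "continuous_map (prod_topology X Y) euclideanreal f" and e: "e > 0"
  shows "\<exists>C. finite C \<and> C \<subseteq> topspace X \<and>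
    (\<forall>x\<in>topspace X. \<exists>c\<in>C. \<forall>y\<in>topspace Y. \<bar>f (x, y) - f (c, y)\<bar> \<le> e)"
proof (rule ccontr)
  assume neg: "\<not> ?thesis"
  have e4: "e / 4 > 0" using e by simp
  have "\<exists>x\<in>topspace X. \<forall>c\<in>C. \<exists>y\<in>topspace Y. \<bar>f (x, y) - f (c, y)\<bar> > e"
    if "finite C" "C \<subseteq> topspace X" for C
    using neg that by (meson not_le)
  then obtain p where p: "\<And>C. finite C \<Longrightarrow> C \<subseteq> topspace X \<Longrightarrow> p C \<in> topspace X \<and>
      (\<forall>c\<in>C. \<exists>y\<in>topspace Y. \<bar>f (p C, y) - f (c, y)\<bar> > e)"
    by metis
  define C where "C = rec_nat {} (\<lambda>_ S. insert (p S) S)"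
  have C: "finite (C n) \<and> C n \<subseteq> topspace X" for n
    by (induction n) (use p in \<open>auto simp: C_def\<close>)
  have CSuc: "C (Suc n) = insert (p (C n)) (C n)" for n by (simp add: C_def)
  define x where "x n = p (C n)" for n
  have x: "x n \<in> topspace X" for n using p C by (auto simp: x_def)
  have xC: "x m \<in> C n" if "m < n" for m n
    using lift_Suc_mono_le[of C "Suc m" n] that CSuc by (auto simp: x_def)
  have sep: "\<exists>y\<in>topspace Y. \<bar>f (x n, y) - f (x m, y)\<bar> > e" if "m < n" for m n
    using p[of "C n"] C xC[OF that] by (auto simp: x_def)
  have "\<exists>W. openin X W \<and> x n \<in> W \<and> (\<forall>a\<in>W. \<forall>y\<in>topspace Y. \<bar>f (a, y) - f (x n, y)\<bar> \<le> e / 4)" for n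
    using pseudocompact_prod_equicontinuous[OF Z f x e4] by blast
  then obtain W where W: "\<And>n. openin X (W n)" "\<And>n. x n \<in> W n"
    "\<And>n a y. a \<in> W n \<Longrightarrow> y \<in> topspace Y \<Longrightarrow> \<bar>f (a, y) - f (x n, y)\<bar> \<le> e / 4"
    by metis
  have ne: "openin Y (topspace Y)" "topspace Y \<noteq> {}" "W n \<noteq> {}" for n
    using W(2)[of n] sep[of 0 1] by auto
  obtain x' y' where xy: "x' \<in> topspace X" "y' \<in> topspace Y"
    and cl: "\<And>G H. openin X G \<Longrightarrow> x' \<in> G \<Longrightarrow> openin Y H \<Longrightarrow> y' \<in> H \<Longrightarrow>
      infinite {n. G \<inter> W n \<noteq> {} \<and> H \<inter> topspace Y \<noteq> {}}"
    by (rule pseudocompact_prod_cluster_point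
        [OF Z, of W "\<lambda>_. topspace Y", OF W(1) ne(3,1,2)]) (rule that)
  obtain G where G: "openin X G" "x' \<in> G"
    "\<And>a y. a \<in> G \<Longrightarrow> y \<in> topspace Y \<Longrightarrow> \<bar>f (a, y) - f (x', y)\<bar> \<le> e / 4"
    using pseudocompact_prod_equicontinuous[OF Z f xy(1) e4] by blast
  have inf: "infinite {n. G \<inter> W n \<noteq> {} \<and> topspace Y \<inter> topspace Y \<noteq> {}}"
    using G xy by (intro cl) auto
  then obtain m where m: "G \<inter> W m \<noteq> {}"
    using infinite_imp_nonempty by blast
  obtain n where n: "m < n" "G \<inter> W n \<noteq> {}"
    using inf unfolding infinite_nat_iff_unbounded by blast
  obtain a where a: "a \<in> G" "a \<in> W m" using m by blast
  obtain b where b: "b \<in> G" "b \<in> W n" using n by blast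
  obtain y where y: "y \<in> topspace Y" "\<bar>f (x n, y) - f (x m, y)\<bar> > e"
    using sep[OF n(1)] by blast
  show False
    using G(3)[OF a(1) y(1)] G(3)[OF b(1) y(1)] W(3)[OF a(2) y(1)] W(3)[OF b(2) y(1)] y(2)
    by linarith
qed

text \<open>One point of S is split off at a time by an open set, leaving infinitely many points of
  S in a disjoint open set where the next choice is made. The set S is general because the points
  must sometimes lie in a prescribed compact set.\<close>

lemma disjoint_open_sequence:
  assumes X: "Hausdorff_space X" "regular_space X" and S: "infinite S" "S \<subseteq> topspace X"
  shows "\<exists>x U. (\<forall>n::nat. x n \<in> S \<and> openin X (U n) \<and> x n \<in> U n) \<and>
    (\<forall>m n. m \<noteq> n \<longrightarrow> U m \<inter> U n = {})"
proof -
  have split: "\<exists>q U V. q \<in> T \<and> openin X U \<and> q \<in> U \<and> openin X V \<and> U \<inter> V = {} \<and> infinite (T \<inter> V)"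
    if T: "infinite T" "T \<subseteq> topspace X" for T
  \<comment> \<open>If every neighbourhood of some p holds infinitely many points of T, separate any
    other point of T from p. If there is no such p, a point q of T has a neighbourhood G with T Int
    G finite, and regularity separates q from the complement of G, which holds the rest of
    T.\<close>
  proof (cases "\<exists>p\<in>topspace X. \<forall>V. openin X V \<and> p \<in> V \<longrightarrow> infinite (T \<inter> V)")
    case True
    then obtain p where p: "p \<in> topspace X" "\<And>V. openin X V \<Longrightarrow> p \<in> V \<Longrightarrow> infinite (T \<inter> V)"
      by blast
    have "infinite (T - {p})" using T(1) by simp
    then obtain q where q: "q \<in> T" "q \<noteq> p"
      using infinite_imp_nonempty by blast
    have "q \<in> topspace X" using q(1) T(2) by (rule subsetD[rotated])
    then obtain U V where "openin X U" "openin X V" "q \<in> U" "p \<in> V" "disjnt U V"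
      using X(1)[unfolded Hausdorff_space_def, rule_format, of q p] p(1) q(2) by auto
    with p(2) q(1) show ?thesis
      by (metis disjnt_def)
  next
    case False
    obtain q where q: "q \<in> T" using T(1) infinite_imp_nonempty by blast
    then have "q \<in> topspace X" using T(2) by (rule subsetD[rotated])
    with False obtain G where G: "openin X G" "q \<in> G" "finite (T \<inter> G)"
      by auto
    have "closedin X (topspace X - G)" "q \<in> topspace X - (topspace X - G)"
      using G q T(2) by auto
    then obtain U V where UV: "openin X U" "openin X V" "q \<in> U" "topspace X - G \<subseteq> V" "disjnt U V"
      using X(2)[unfolded regular_space_def, rule_format, of "topspace X - G" q] by auto
    have "T - T \<inter> G \<subseteq> T \<inter> V" using T(2) UV(4) by blast
    moreover have "infinite (T - T \<inter> G)" using T(1) G(3) by (rule Diff_infinite_finite[rotated])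
    ultimately have "infinite (T \<inter> V)" by (rule infinite_super)
    with UV q show ?thesis
      by (metis disjnt_def)
  qed
  have step: "\<exists>q U V. q \<in> S \<and> openin X U \<and> q \<in> U \<and> U \<subseteq> W \<and> openin X V \<and> V \<subseteq> W \<and> U \<inter> V = {} \<and>
      infinite (S \<inter> V)"
    if W: "openin X W" "infinite (S \<inter> W)" for W
  proof -
    have "S \<inter> W \<subseteq> topspace X" using S(2) by blast
    from split[OF W(2) this] obtain q U V where *: "q \<in> S \<inter> W" "openin X U" "q \<in> U" "openin X V"
      "U \<inter> V = {}" "infinite (S \<inter> W \<inter> V)"
      by (elim exE conjE)
    have "openin X (U \<inter> W)" "openin X (V \<inter> W)"
      using *(2,4) W(1) by (simp_all add: openin_Int)
    moreover have "S \<inter> W \<inter> V = S \<inter> (V \<inter> W)" "(U \<inter> W) \<inter> (V \<inter> W) = {}"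
      using *(5) by blast+
    ultimately have P: "q \<in> S \<and> openin X (U \<inter> W) \<and> q \<in> U \<inter> W \<and> U \<inter> W \<subseteq> W \<and> openin X (V \<inter> W) \<and>
        V \<inter> W \<subseteq> W \<and> (U \<inter> W) \<inter> (V \<inter> W) = {} \<and> infinite (S \<inter> (V \<inter> W))"
      using *(1,3,6) by (intro conjI) (assumption | simp)+
    show ?thesis by (rule exI, rule exI, rule exI, rule P)
  qed
  obtain q u v where quv: "\<And>W. openin X W \<Longrightarrow> infinite (S \<inter> W) \<Longrightarrow>
      q W \<in> S \<and> openin X (u W) \<and> q W \<in> u W \<and> u W \<subseteq> W \<and> openin X (v W) \<and> v W \<subseteq> W \<and>
      u W \<inter> v W = {} \<and> infinite (S \<inter> v W)"
    using step by metis
  define W where "W n = (v ^^ n) (topspace X)" for n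
  have WSuc: "W (Suc n) = v (W n)" for n by (simp add: W_def)
  have W: "openin X (W n)" "infinite (S \<inter> W n)" for n
  proof (induction n)
    case 0
    have "S \<inter> topspace X = S" using S(2) by blast
    with S(1) show "openin X (W 0)" "infinite (S \<inter> W 0)" by (simp_all add: W_def)
  next
    case (Suc n)
    from quv[OF Suc] show "openin X (W (Suc n))" "infinite (S \<inter> W (Suc n))"
      unfolding WSuc by blast+
  qed
  have quvW: "q (W n) \<in> S" "openin X (u (W n))" "q (W n) \<in> u (W n)" "u (W n) \<subseteq> W n"
    "W (Suc n) \<subseteq> W n" "u (W n) \<inter> W (Suc n) = {}" for n
    using quv[OF W] unfolding WSuc by blast+
  have lt: "u (W m) \<inter> u (W n) = {}" if "m < n" for m n
  proof -
    have "W n \<subseteq> W (Suc m)"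
      using lift_Suc_antimono_le[of W "Suc m" n, OF quvW(5)] that by simp
    with quvW(4)[of n] quvW(6)[of m] show ?thesis by blast
  qed
  have "u (W m) \<inter> u (W n) = {}" if "m \<noteq> n" for m n
    using that lt[of m n] lt[of n m] by (metis Int_commute nat_neq_iff)
  with quvW(1-3) have "(\<forall>n. q (W n) \<in> S \<and> openin X (u (W n)) \<and> q (W n) \<in> u (W n)) \<and>
      (\<forall>m n. m \<noteq> n \<longrightarrow> u (W m) \<inter> u (W n) = {})"
    by blast
  then show ?thesis
    by (intro exI[of _ "\<lambda>n. q (W n)"] exI[of _ "\<lambda>n. u (W n)"])
qed

section \<open>Rademacher averages\<close>

text \<open>The set s encodes a sign vector, so a sum over \<open>Pow A\<close> is 2^card A times an
  expectation over independent signs.\<close>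

definition rademacher :: "nat set \<Rightarrow> nat \<Rightarrow> real" where
  "rademacher s i = (if i \<in> s then 1 else - 1)"

text \<open>Orthogonality of independent signs: the second moment of their sum is the number of
  terms.\<close>

lemma rademacher_square_sum:
  assumes "finite A"
  shows "(\<Sum>s\<in>Pow A. (\<Sum>i\<in>A \<inter> J. rademacher s i)\<^sup>2) = 2 ^ card A * card (A \<inter> J)"
  using assms
proof (induction A)
  case (insert a A)
  let ?S = "\<lambda>s. \<Sum>i\<in>A \<inter> J. rademacher s i"
  have inj: "inj_on (insert a) (Pow A)"
    using insert.hyps(2) by (auto simp: inj_on_def)
  have ins: "(\<Sum>i\<in>A \<inter> J. rademacher (insert a s) i) = ?S s" for s
    using insert.hyps(2) by (intro sum.cong) (auto simp: rademacher_def)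
  have "(\<Sum>s\<in>Pow (insert a A). (\<Sum>i\<in>insert a A \<inter> J. rademacher s i)\<^sup>2) =
      (\<Sum>s\<in>Pow A. (\<Sum>i\<in>insert a A \<inter> J. rademacher s i)\<^sup>2) +
      (\<Sum>s\<in>Pow A. (\<Sum>i\<in>insert a A \<inter> J. rademacher (insert a s) i)\<^sup>2)"
    unfolding Pow_insert using insert.hyps inj
    by (subst sum.union_disjoint) (auto simp: sum.reindex)
  \<comment> \<open>The two signs of a contribute (t - 1)^2 + (t + 1)^2 = 2 t^2 + 2.\<close>
  also have "\<dots> = (\<Sum>s\<in>Pow A. 2 * (?S s)\<^sup>2 + (if a \<in> J then 2 else 0))"
  proof (cases "a \<in> J")
    case True
    then have "insert a A \<inter> J = insert a (A \<inter> J)" by blast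
    then have split: "(\<Sum>i\<in>insert a A \<inter> J. rademacher s i) =
        rademacher s a + (\<Sum>i\<in>A \<inter> J. rademacher s i)" for s
      using insert.hyps by simp
    have "(\<Sum>i\<in>insert a A \<inter> J. rademacher s i)\<^sup>2 +
        (\<Sum>i\<in>insert a A \<inter> J. rademacher (insert a s) i)\<^sup>2 = 2 * (?S s)\<^sup>2 + 2"
      if "s \<in> Pow A" for s
    proof -
      have "rademacher s a = - 1" "rademacher (insert a s) a = 1"
        using that insert.hyps(2) by (auto simp: rademacher_def)
      then show ?thesis
        unfolding split ins by (simp add: power2_eq_square algebra_simps)
    qed
    with True show ?thesis
      by (simp flip: sum.distrib)
  next
    case False
    then have "insert a A \<inter> J = A \<inter> J" by blast
    then show ?thesis
      using False ins by (simp add: sum_distrib_left)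
  qed
  also have "\<dots> = 2 * (2 ^ card A * card (A \<inter> J)) + 2 ^ card A * (if a \<in> J then 2 else 0)"
    using insert.hyps(1) insert.IH
    by (simp add: sum.distrib card_Pow flip: sum_distrib_left)
  also have "\<dots> = 2 ^ card (insert a A) * card (insert a A \<inter> J)"
    using insert.hyps by (simp add: Int_insert_left algebra_simps)
  finally show ?case .
qed simp

text \<open>The first moment is controlled by the second through 2 r |t| <= t^2 + r^2 with r = sqrt
  (card A). The bound is uniform in J, so it applies to every class of rows.\<close>

lemma rademacher_abs_sum:
  assumes A: "finite A" "A \<noteq> {}"
  shows "(\<Sum>s\<in>Pow A. \<bar>\<Sum>i\<in>A \<inter> J. rademacher s i\<bar>) \<le> 2 ^ card A * sqrt (card A)"
proof -
  let ?S = "\<lambda>s. \<Sum>i\<in>A \<inter> J. rademacher s i"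
  define r where "r = sqrt (card A)"
  have r: "r > 0" "r * r = card A"
    using A by (auto simp: r_def card_gt_0_iff)
  have am_gm: "2 * r * \<bar>t\<bar> \<le> t\<^sup>2 + r * r" for t :: real
    using sum_squares_bound[of "\<bar>t\<bar>" r] by (simp add: power2_eq_square mult_ac)
  have "2 * r * (\<Sum>s\<in>Pow A. \<bar>?S s\<bar>) \<le> (\<Sum>s\<in>Pow A. (?S s)\<^sup>2 + r * r)"
    unfolding sum_distrib_left by (intro sum_mono am_gm)
  also have "\<dots> = 2 ^ card A * card (A \<inter> J) + 2 ^ card A * (r * r)"
    using A(1) by (simp add: sum.distrib rademacher_square_sum card_Pow)
  also have "\<dots> \<le> 2 ^ card A * (r * r) + 2 ^ card A * (r * r)"
    using A(1) by (simp add: r(2) card_mono)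
  also have "\<dots> = 2 * r * (2 ^ card A * r)"
    by simp
  finally show ?thesis
    using r(1) by (simp add: r_def[symmetric])
qed

text \<open>
  Replacing the functions \<open>F i\<close> by finitely many functions \<open>G c\<close> costs \<open>e\<close> per term, and on each
  fibre of \<open>q\<close> the signs cancel down to the order \<open>sqrt (card A)\<close>.
\<close>

lemma rademacher_average_bound:
  fixes F :: "nat \<Rightarrow> nat set \<Rightarrow> real" and G :: "'c \<Rightarrow> nat set \<Rightarrow> real" and e M :: real
  assumes A: "finite A" "A \<noteq> {}" and C: "finite C" "q \<in> A \<rightarrow> C"
    and FG: "\<And>i s. i \<in> A \<Longrightarrow> s \<in> Pow A \<Longrightarrow> \<bar>F i s - G (q i) s\<bar> \<le> e"
    and G: "\<And>c s. c \<in> C \<Longrightarrow> s \<in> Pow A \<Longrightarrow> \<bar>G c s\<bar> \<le> M"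
  shows "\<bar>\<Sum>s\<in>Pow A. \<Sum>i\<in>A. rademacher s i * F i s\<bar> \<le>
    2 ^ card A * (card A * e + card C * M * sqrt (card A))"
\<comment> \<open>An empty C is impossible, since q maps the nonempty A into it; a member of C is
  needed to see that M is nonnegative.\<close>
proof (cases "C = {}")
  case True
  then show ?thesis using A C by auto
next
  case False
  then obtain c where "c \<in> C" by blast
  then have M: "M \<ge> 0" using G[of c "{}"] by auto
  let ?S = "\<lambda>c s. \<Sum>i\<in>A \<inter> {i. q i = c}. rademacher s i"
  have pointwise: "\<bar>\<Sum>i\<in>A. rademacher s i * F i s\<bar> \<le> card A * e + (\<Sum>c\<in>C. M * \<bar>?S c s\<bar>)"
    if s: "s \<in> Pow A" for s
  proof -
    have "(\<Sum>i\<in>A. rademacher s i * G (q i) s) = (\<Sum>c\<in>C. \<Sum>i\<in>{i\<in>A. q i = c}. rademacher s i * G (q i) s)"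
      using A C by (intro sum.group[symmetric]) auto
    also have "\<dots> = (\<Sum>c\<in>C. G c s * ?S c s)"
      by (auto simp: sum_distrib_left mult_ac Int_def intro!: sum.cong)
    finally have "(\<Sum>i\<in>A. rademacher s i * F i s) =
        (\<Sum>i\<in>A. rademacher s i * (F i s - G (q i) s)) + (\<Sum>c\<in>C. G c s * ?S c s)"
      by (simp add: right_diff_distrib sum_subtractf)
    moreover have "\<bar>\<Sum>i\<in>A. rademacher s i * (F i s - G (q i) s)\<bar> \<le> (\<Sum>i\<in>A. e)"
      using FG s by (intro order_trans[OF sum_abs] sum_mono) (auto simp: abs_mult rademacher_def)
    moreover have "\<bar>\<Sum>c\<in>C. G c s * ?S c s\<bar> \<le> (\<Sum>c\<in>C. M * \<bar>?S c s\<bar>)"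
      using G s
      by (intro order_trans[OF sum_abs] sum_mono) (auto simp: abs_mult intro!: mult_right_mono)
    ultimately show ?thesis by simp
  qed
  have "\<bar>\<Sum>s\<in>Pow A. \<Sum>i\<in>A. rademacher s i * F i s\<bar> \<le>
      (\<Sum>s\<in>Pow A. card A * e + (\<Sum>c\<in>C. M * \<bar>?S c s\<bar>))"
    by (intro order_trans[OF sum_abs] sum_mono pointwise)
  also have "\<dots> = 2 ^ card A * (card A * e) + (\<Sum>c\<in>C. M * (\<Sum>s\<in>Pow A. \<bar>?S c s\<bar>))"
    using A(1) by (simp add: sum.distrib card_Pow sum.swap[of _ C] sum_distrib_left)
  also have "\<dots> \<le> 2 ^ card A * (card A * e) + (\<Sum>c\<in>C. M * (2 ^ card A * sqrt (card A)))"
    by (intro add_left_mono sum_mono mult_left_mono rademacher_abs_sum A M)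
  also have "\<dots> = 2 ^ card A * (card A * e + card C * M * sqrt (card A))"
    by (simp add: algebra_simps)
  finally show ?thesis .
qed

lemma finite_disjoint_indices:
  assumes "finite B" "\<And>m n. m \<noteq> n \<Longrightarrow> V m \<inter> V n = {}"
  shows "finite {n. V n \<inter> B \<noteq> {}}"
proof -
  have "finite {n. b \<in> V n}" for b
  proof (cases "\<exists>n. b \<in> V n")
    case True
    then obtain n where "b \<in> V n" by blast
    then have "{n. b \<in> V n} \<subseteq> {n}" using assms(2) by blast
    then show ?thesis by (rule finite_subset) simp
  qed simp
  then have "finite (\<Union>b\<in>B. {n. b \<in> V n})"
    using assms(1) by blast
  moreover have "{n. V n \<inter> B \<noteq> {}} = (\<Union>b\<in>B. {n. b \<in> V n})" by blast
  ultimately show ?thesis by simp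
qed

section \<open>A biorthogonal system on a pseudocompact product\<close>

text \<open>
  The \<open>n\<close>-th functional averages, with Rademacher signs, over the grid of the points
  \<open>x (n, i)\<close> with \<open>i \<le> n\<close> and \<open>y (n, s)\<close> with \<open>s \<subseteq> {..n}\<close>; the pairs \<open>(n, i)\<close>, \<open>(n, s)\<close> are coded
  by natural numbers.
\<close>

locale pseudocompact_product =
  fixes X :: "'a topology" and Y :: "'b topology"
    and x :: "nat \<Rightarrow> 'a" and U :: "nat \<Rightarrow> 'a set" and y :: "nat \<Rightarrow> 'b" and V :: "nat \<Rightarrow> 'b set"
  assumes X: "completely_regular_space X" and Y: "completely_regular_space Y"
    and pseudocompact: "pseudocompact_space (prod_topology X Y)"
    and U: "\<And>k. openin X (U k)" "\<And>k. x k \<in> U k" "\<And>k l. k \<noteq> l \<Longrightarrow> U k \<inter> U l = {}"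
    and V: "\<And>k. openin Y (V k)" "\<And>k. y k \<in> V k" "\<And>k l. k \<noteq> l \<Longrightarrow> V k \<inter> V l = {}"
begin

text \<open>Since n enters both codes, different n use different rows and also different columns.
  Either coordinate alone determines n, which is used for disjointness and for compact sets with one
  finite projection.\<close>

abbreviation row :: "nat \<Rightarrow> nat \<times> nat set \<Rightarrow> nat" where
  "row n k \<equiv> prod_encode (n, fst k)"

abbreviation col :: "nat \<Rightarrow> nat \<times> nat set \<Rightarrow> nat" where
  "col n k \<equiv> prod_encode (n, set_encode (snd k))"

definition grid :: "nat \<Rightarrow> (nat \<times> nat set) set" where
  "grid n = {..n} \<times> Pow {..n}"

definition grid_point :: "nat \<Rightarrow> nat \<times> nat set \<Rightarrow> 'a \<times> 'b" where
  "grid_point n k = (x (row n k), y (col n k))"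

definition weight :: "nat \<Rightarrow> nat \<times> nat set \<Rightarrow> real" where
  "weight n k = rademacher (snd k) (fst k) / card (grid n)"

definition u :: "nat \<Rightarrow> 'a \<Rightarrow> real" where
  "u k = (SOME f. f \<in> continuous_functions X \<and> f (x k) = 1 \<and> (\<forall>z. 0 \<le> f z \<and> f z \<le> 1) \<and>
    (\<forall>z. z \<notin> U k \<longrightarrow> f z = 0))"

definition v :: "nat \<Rightarrow> 'b \<Rightarrow> real" where
  "v k = (SOME f. f \<in> continuous_functions Y \<and> f (y k) = 1 \<and> (\<forall>z. 0 \<le> f z \<and> f z \<le> 1) \<and>
    (\<forall>z. z \<notin> V k \<longrightarrow> f z = 0))"

lemma u: "u k \<in> continuous_functions X" "u k (x k) = 1" "0 \<le> u k a" "u k a \<le> 1"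
    "a \<notin> U k \<Longrightarrow> u k a = 0"
proof -
  have "\<exists>f. f \<in> continuous_functions X \<and> f (x k) = 1 \<and> (\<forall>z. 0 \<le> f z \<and> f z \<le> 1) \<and>
    (\<forall>z. z \<notin> U k \<longrightarrow> f z = 0)"
    using completely_regular_bump[OF X U(1,2)] by blast
  from someI_ex[OF this, folded u_def]
  show "u k \<in> continuous_functions X" "u k (x k) = 1" "0 \<le> u k a" "u k a \<le> 1"
    "a \<notin> U k \<Longrightarrow> u k a = 0" by auto
qed

lemma v: "v k \<in> continuous_functions Y" "v k (y k) = 1" "0 \<le> v k b" "v k b \<le> 1"
    "b \<notin> V k \<Longrightarrow> v k b = 0"
proof -
  have "\<exists>f. f \<in> continuous_functions Y \<and> f (y k) = 1 \<and> (\<forall>z. 0 \<le> f z \<and> f z \<le> 1) \<and>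
    (\<forall>z. z \<notin> V k \<longrightarrow> f z = 0)"
    using completely_regular_bump[OF Y V(1,2)] by blast
  from someI_ex[OF this, folded v_def]
  show "v k \<in> continuous_functions Y" "v k (y k) = 1" "0 \<le> v k b" "v k b \<le> 1"
    "b \<notin> V k \<Longrightarrow> v k b = 0" by auto
qed

text \<open>The signs repeat those of \<open>weight\<close>, so pairing the two averages the squares
  of signs and gives 1.\<close>

definition \<phi> :: "nat \<Rightarrow> 'a \<times> 'b \<Rightarrow> real" where
  "\<phi> n z = (\<Sum>k\<in>grid n. rademacher (snd k) (fst k) * (u (row n k) (fst z) * v (col n k) (snd z)))"

lemma finite_grid: "finite (grid n)" and card_grid_pos: "card (grid n) > 0"
  by (auto simp: grid_def card_gt_0_iff)

lemma grid_eqI: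
  assumes "k \<in> grid n" "l \<in> grid n" "row n k = row m l" "col n k = col m l"
  shows "k = l"
proof -
  \<comment> \<open>Finiteness is needed because \<open>set_encode\<close> is injective on finite
    sets only.\<close>
  have "snd k \<subseteq> {..n}" "snd l \<subseteq> {..n}"
    using assms(1,2) by (auto simp: grid_def)
  then have "finite (snd k)" "finite (snd l)"
    using finite_subset[OF _ finite_atMost] by blast+
  with assms(3,4) show ?thesis
    by (auto simp: set_encode_eq prod_eq_iff)
qed

lemma u_unique: "u k a \<noteq> 0 \<Longrightarrow> u l a \<noteq> 0 \<Longrightarrow> k = l"
  using u(5)[of a] U(3) by blast

lemma v_unique: "v k b \<noteq> 0 \<Longrightarrow> v l b \<noteq> 0 \<Longrightarrow> k = l"
  using v(5)[of b] V(3) by blast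

text \<open>Two nonzero summands would share row and column, hence be the same cell. A single signed
  product remains, which gives the bound 1 and locates the support.\<close>

lemma \<phi>_nonzero:
  assumes "\<phi> n z \<noteq> 0"
  shows "\<exists>k\<in>grid n. u (row n k) (fst z) \<noteq> 0 \<and> v (col n k) (snd z) \<noteq> 0 \<and>
    \<phi> n z = rademacher (snd k) (fst k) * (u (row n k) (fst z) * v (col n k) (snd z))"
proof -
  let ?t = "\<lambda>k. rademacher (snd k) (fst k) * (u (row n k) (fst z) * v (col n k) (snd z))"
  obtain k where k: "k \<in> grid n" "?t k \<noteq> 0"
    using assms unfolding \<phi>_def by (meson sum.neutral)
  then have uv: "u (row n k) (fst z) \<noteq> 0" "v (col n k) (snd z) \<noteq> 0" by auto
  have "?t l = 0" if "l \<in> grid n - {k}" for l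
  proof (rule ccontr)
    assume "?t l \<noteq> 0"
    then have "u (row n l) (fst z) \<noteq> 0" "v (col n l) (snd z) \<noteq> 0" by auto
    then have "row n l = row n k" "col n l = col n k"
      using uv by (blast intro: u_unique, blast intro: v_unique)
    then have "l = k"
      using that k(1) by (intro grid_eqI[of l n k n]) auto
    with that show False by simp
  qed
  then have "sum ?t (grid n - {k}) = 0" by (intro sum.neutral) blast
  then have "\<phi> n z = ?t k"
    unfolding \<phi>_def by (simp only: sum.remove[OF finite_grid k(1)] add_0_right)
  with k(1) uv show ?thesis by blast
qed

lemma \<phi>_grid_point:
  assumes "k \<in> grid n"
  shows "\<phi> n (grid_point n k) = rademacher (snd k) (fst k)"
proof -
  have "u (row n l) (x (row n k)) * v (col n l) (y (col n k)) = 0" if "l \<in> grid n - {k}" for l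
  proof (rule ccontr)
    assume "\<not> ?thesis"
    then have "row n l = row n k" "col n l = col n k"
      using u_unique[of "row n l" "x (row n k)" "row n k"] v_unique[of "col n l" "y (col n k)" "col n k"]
      by (auto simp: u(2) v(2))
    then have "l = k"
      using that assms by (intro grid_eqI[of l n k n]) auto
    with that show False by simp
  qed
  then have "(\<Sum>l\<in>grid n - {k}. rademacher (snd l) (fst l) *
      (u (row n l) (x (row n k)) * v (col n l) (y (col n k)))) = 0"
    by (intro sum.neutral) simp
  then show ?thesis
    unfolding \<phi>_def grid_point_def fst_conv snd_conv
    by (simp only: sum.remove[OF finite_grid assms] u(2) v(2) add_0_right mult_1_right)
qed

lemma \<phi>_in_continuous_functions: "\<phi> n \<in> continuous_functions (prod_topology X Y)"
proof -
  have "continuous_map (prod_topology X Y) euclideanreal (\<lambda>z. u k (fst z))"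
    "continuous_map (prod_topology X Y) euclideanreal (\<lambda>z. v k (snd z))" for k
    using u(1)[of k] v(1)[of k]
      continuous_map_compose[OF continuous_map_fst, of X euclideanreal "u k" Y]
      continuous_map_compose[OF continuous_map_snd, of Y euclideanreal "v k" X]
    by (auto simp: continuous_functions_def o_def)
  then have "continuous_map (prod_topology X Y) euclideanreal (\<phi> n)"
    unfolding \<phi>_def using finite_grid
    by (intro continuous_map_sum continuous_map_real_mult continuous_map_canonical_const)
  moreover have "\<phi> n z = 0" if "z \<notin> topspace (prod_topology X Y)" for z
  proof -
    have "fst z \<notin> topspace X \<or> snd z \<notin> topspace Y"
      using that by (auto simp: mem_Times_iff)
    then have "u k (fst z) * v l (snd z) = 0" for k l
      using u(1)[of k] v(1)[of l] by (auto simp: continuous_functions_def)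
    then show ?thesis
      unfolding \<phi>_def by (intro sum.neutral) simp
  qed
  ultimately show ?thesis by (simp add: continuous_functions_def)
qed

lemma x_in: "x k \<in> topspace X" and y_in: "y k \<in> topspace Y"
  using U(1,2) V(1,2) openin_subset by blast+

text \<open>For each e the average is at most e + B / sqrt (n + 1), where B involves the size of a
  finite e-net of sections and so depends on e but not on n.\<close>

lemma average_null:
  assumes f: "f \<in> continuous_functions (prod_topology X Y)"
  shows "(\<lambda>n. \<Sum>k\<in>grid n. weight n k * f (grid_point n k)) \<in> null_sequences"
proof -
  have fc: "continuous_map (prod_topology X Y) euclideanreal f"
    using f by (simp add: continuous_functions_def)
  obtain M where M: "\<And>z. z \<in> topspace (prod_topology X Y) \<Longrightarrow> \<bar>f z\<bar> \<le> M"
    using pseudocompact fc unfolding pseudocompact_space_def by blast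
  let ?a = "\<lambda>n. \<Sum>k\<in>grid n. weight n k * f (grid_point n k)"
  have eq: "?a n = (\<Sum>s\<in>Pow {..n}. \<Sum>i\<in>{..n}. rademacher s i * f (grid_point n (i, s))) /
      (real (Suc n) * 2 ^ Suc n)" for n
  proof -
    have "?a n = (\<Sum>(i, s)\<in>grid n. rademacher s i * f (grid_point n (i, s))) / card (grid n)"
      by (simp add: weight_def sum_divide_distrib case_prod_unfold)
    also have "(\<Sum>(i, s)\<in>grid n. rademacher s i * f (grid_point n (i, s))) =
        (\<Sum>s\<in>Pow {..n}. \<Sum>i\<in>{..n}. rademacher s i * f (grid_point n (i, s)))"
      unfolding grid_def sum.cartesian_product[symmetric] by (rule sum.swap)
    also have "card (grid n) = Suc n * 2 ^ Suc n"
      by (simp add: grid_def card_cartesian_product card_Pow)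
    finally show ?thesis
      by (simp only: of_nat_mult of_nat_power of_nat_numeral)
  qed
  have bound: "\<exists>B. \<forall>n. \<bar>?a n\<bar> \<le> e + B / sqrt (Suc n)" if e: "e > 0" for e
  proof -
    obtain C where C: "finite C" "C \<subseteq> topspace X"
      "\<And>a. a \<in> topspace X \<Longrightarrow> \<exists>c\<in>C. \<forall>b\<in>topspace Y. \<bar>f (a, b) - f (c, b)\<bar> \<le> e"
      using pseudocompact_prod_totally_bounded[OF _ pseudocompact fc e] X Y
      by (auto simp: completely_regular_space_prod_topology)
    obtain q where q: "\<And>a. a \<in> topspace X \<Longrightarrow> q a \<in> C \<and> (\<forall>b\<in>topspace Y. \<bar>f (a, b) - f (q a, b)\<bar> \<le> e)"
      using C(3) by metis
    have "\<bar>?a n\<bar> \<le> e + card C * M / sqrt (Suc n)" for n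
    proof -
      let ?N = "real (Suc n)"
      have "\<bar>\<Sum>s\<in>Pow {..n}. \<Sum>i\<in>{..n}. rademacher s i * f (grid_point n (i, s))\<bar> \<le>
          2 ^ card {..n} * (card {..n} * e + card C * M * sqrt (card {..n}))"
      \<comment> \<open>Row i is assigned to a centre of the net; replacing the row by its centre
        costs at most e in every column.\<close>
      proof (rule rademacher_average_bound[where q = "\<lambda>i. q (x (prod_encode (n, i)))"
            and G = "\<lambda>c s. f (c, y (prod_encode (n, set_encode s)))"])
        show "\<bar>f (c, y (prod_encode (n, set_encode s)))\<bar> \<le> M" if "c \<in> C" for c s
          using that C(2) y_in by (intro M) auto
      qed (use C q x_in y_in in \<open>auto simp: grid_point_def\<close>)
      \<comment> \<open>Writing sqrt N as N / sqrt N lets the normalising factor N 2^N be taken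
        out.\<close>
      also have "\<dots> = 2 ^ Suc n * (?N * e + card C * M * (?N / sqrt ?N))"
        by (simp add: real_div_sqrt del: of_nat_Suc)
      also have "\<dots> = (e + card C * M / sqrt ?N) * (?N * 2 ^ Suc n)"
        by (simp add: algebra_simps del: of_nat_Suc power_Suc)
      finally show ?thesis
        unfolding eq abs_divide by (subst pos_divide_le_eq) (simp_all del: of_nat_Suc power_Suc)
    qed
    then show ?thesis by blast
  qed
  have "?a \<longlonglongrightarrow> 0"
  proof (rule LIMSEQ_I)
    fix r :: real assume r: "r > 0"
    then obtain B where B: "\<And>n. \<bar>?a n\<bar> \<le> r / 2 + B / sqrt (Suc n)"
      using bound[of "r / 2"] by auto
    have "(\<lambda>n. B / sqrt (Suc n)) \<longlonglongrightarrow> 0"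
      by (intro real_tendsto_divide_at_top[OF tendsto_const]
          filterlim_compose[OF sqrt_at_top] filterlim_compose[OF filterlim_real_sequentially filterlim_Suc])
    then have "\<forall>\<^sub>F n in sequentially. B / sqrt (Suc n) < r / 2"
      using r by (intro order_tendstoD) auto
    then obtain n0 where n0: "\<And>n. n \<ge> n0 \<Longrightarrow> B / sqrt (Suc n) < r / 2"
      unfolding eventually_sequentially by blast
    have "norm (?a n - 0) < r" if "n \<ge> n0" for n
      using B[of n] n0[OF that] unfolding real_norm_def diff_0_right by linarith
    then show "\<exists>n0. \<forall>n\<ge>n0. norm (?a n - 0) < r" by blast
  qed
  then show ?thesis by (simp add: null_sequences_def)
qed

lemma weight_abs_sum: "(\<Sum>k\<in>grid n. \<bar>weight n k\<bar>) \<le> 1"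
proof -
  have "\<bar>weight n k\<bar> = 1 / card (grid n)" for k
    by (simp add: weight_def rademacher_def abs_divide)
  then show ?thesis by simp
qed

sublocale biorthogonal_system "prod_topology X Y" \<phi> grid grid_point weight
proof
  show "m = n" if "\<phi> m z \<noteq> 0" "\<phi> n z \<noteq> 0" for m n z
  proof -
    from \<phi>_nonzero[OF that(1)] \<phi>_nonzero[OF that(2)]
    obtain k l where "u (row m k) (fst z) \<noteq> 0" "u (row n l) (fst z) \<noteq> 0"
      by blast
    then have "row m k = row n l" by (rule u_unique)
    then show ?thesis by simp
  qed
  show "\<phi> n (grid_point m k) = 0" if "k \<in> grid m" "n \<noteq> m" for m n k
  proof (rule ccontr)
    assume "\<phi> n (grid_point m k) \<noteq> 0"
    from \<phi>_nonzero[OF this] obtain l where "u (row n l) (x (row m k)) \<noteq> 0"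
      by (auto simp: grid_point_def)
    moreover have "u (row m k) (x (row m k)) \<noteq> 0" by (simp add: u(2))
    ultimately have "row n l = row m k" by (rule u_unique)
    with that(2) show False by simp
  qed
  show "(\<Sum>k\<in>grid n. weight n k * \<phi> n (grid_point n k)) = 1" for n
  proof -
    have "(\<Sum>k\<in>grid n. weight n k * \<phi> n (grid_point n k)) = (\<Sum>k\<in>grid n. 1 / card (grid n))"
      by (intro sum.cong) (auto simp: \<phi>_grid_point weight_def rademacher_def)
    then show ?thesis using card_grid_pos[of n] by simp
  qed
qed (use \<phi>_in_continuous_functions finite_grid x_in y_in in \<open>auto simp: grid_point_def\<close>)

sublocale bounded_biorthogonal_system "prod_topology X Y" \<phi> grid grid_point weight
proof
  show "\<bar>\<phi> n z\<bar> \<le> 1" for n z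
  proof (cases "\<phi> n z = 0")
    case False
    then obtain k where
      "\<phi> n z = rademacher (snd k) (fst k) * (u (row n k) (fst z) * v (col n k) (snd z))"
      using \<phi>_nonzero by metis
    then have "\<bar>\<phi> n z\<bar> = u (row n k) (fst z) * v (col n k) (snd z)"
      using u(3)[of "row n k"] v(3)[of "col n k"] by (simp add: abs_mult rademacher_def)
    also have "\<dots> \<le> 1"
      using u(3,4) v(3,4) by (intro mult_le_one)
    finally show ?thesis .
  qed simp
qed (use average_null in \<open>simp add: functional_def\<close>)

text \<open>A compact K has a finite projection to one factor. A finite set meets only finitely many
  of the disjoint sets there, and decoding their indices gives the finitely many n whose
  \<open>\<phi> n\<close> can be nonzero on K.\<close>

lemma quotient_Ck_c0_p_if_compact_finite:
  assumes "(\<forall>K. compactin X K \<longrightarrow> finite K) \<or> (\<forall>K. compactin Y K \<longrightarrow> finite K)"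
  shows "tvs_quotient_map (Ck (prod_topology X Y)) c0_p functional"
proof (rule quotient_Ck_c0_p)
  fix K assume K: "compactin (prod_topology X Y) K"
  have "compactin X (fst ` K)" "compactin Y (snd ` K)"
    using image_compactin[OF K continuous_map_fst] image_compactin[OF K continuous_map_snd] .
  with assms have fin: "finite (fst ` K) \<or> finite (snd ` K)" by blast
  let ?I = "if finite (fst ` K) then {k. U k \<inter> fst ` K \<noteq> {}} else {k. V k \<inter> snd ` K \<noteq> {}}"
  have "finite ?I"
    using fin by (auto intro!: finite_disjoint_indices U(3) V(3))
  then have "finite ((\<lambda>k. fst (prod_decode k)) ` ?I)" by (rule finite_imageI)
  moreover have "n \<in> (\<lambda>k. fst (prod_decode k)) ` ?I" if "w \<in> K" "\<phi> n w \<noteq> 0" for n w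
  proof -
    from \<phi>_nonzero[OF that(2)]
    obtain k where "u (row n k) (fst w) \<noteq> 0" "v (col n k) (snd w) \<noteq> 0"
      by blast
    then have "fst w \<in> U (row n k)" "snd w \<in> V (col n k)"
      using u(5) v(5) by blast+
    with that(1) have "row n k \<in> ?I \<or> col n k \<in> ?I" by auto
    then show ?thesis
    proof
      assume "row n k \<in> ?I"
      then show ?thesis by (rule rev_image_eqI) simp
    next
      assume "col n k \<in> ?I"
      then show ?thesis by (rule rev_image_eqI) simp
    qed
  qed
  ultimately show "\<exists>N. finite N \<and> (\<forall>n. n \<notin> N \<longrightarrow> (\<forall>w\<in>K. \<phi> n w = 0))"
    by (intro exI[of _ "(\<lambda>k. fst (prod_decode k)) ` ?I"]) blast
qed

lemma quotient_Ck_c0_if_compact: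
  assumes "compactin X K" "compactin Y L" "\<And>k. x k \<in> K" "\<And>k. y k \<in> L"
  shows "tvs_quotient_map (Ck (prod_topology X Y)) c0 functional"
proof (rule quotient_Ck_c0)
  show "compactin (prod_topology X Y) (K \<times> L)"
    using assms(1,2) by (simp add: compactin_Times)
  show "grid_point n k \<in> K \<times> L" for n k
    using assms(3,4) by (simp add: grid_point_def)
qed (rule weight_abs_sum)

end

section \<open>Assembly of the cases, by pseudocompactness and by infinite compact subsets\<close>

theorem corollary1p10:
  fixes X :: "'a topology" and Y :: "'b topology"
  assumes "Tychonoff_space X" "infinite (topspace X)"
    and "Tychonoff_space Y" "infinite (topspace Y)"
  shows "((\<exists>T. tvs_quotient_map (Cp (prod_topology X Y)) R_omega T) \<or>
          (\<exists>T. tvs_quotient_map (Cp (prod_topology X Y)) c0_p T)) \<and>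
         (\<exists>(E :: (nat \<Rightarrow> real) topology) T.
            topological_vector_space E \<and>
            tvs_quotient_map (Ck (prod_topology X Y)) E T \<and>
            (tvs_isomorphic E R_omega \<or> tvs_isomorphic E c0_p \<or> tvs_isomorphic E c0))"
proof (cases "pseudocompact_space (prod_topology X Y)")
  case False
  then obtain T where T: "tvs_quotient_map (Cp (prod_topology X Y)) R_omega T"
    "tvs_quotient_map (Ck (prod_topology X Y)) R_omega T"
    using not_pseudocompact_quotient_R_omega by blast
  show ?thesis
    by (rule conjI, rule disjI1, rule exI, rule T(1), rule exI[of _ R_omega], rule exI[of _ T])
      (simp add: T(2) tvs_R_omega tvs_isomorphic_refl)
next
  case True
  have X: "completely_regular_space X" "Hausdorff_space X"
    and Y: "completely_regular_space Y" "Hausdorff_space Y"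
    using assms by (auto simp: Tychonoff_space_def)
  have regular: "regular_space X" "regular_space Y"
    using X(1) Y(1) by (auto intro: completely_regular_imp_regular_space)
  show ?thesis
  proof (cases "(\<forall>K. compactin X K \<longrightarrow> finite K) \<or> (\<forall>K. compactin Y K \<longrightarrow> finite K)")
    case compact_finite: True
    obtain x U where xU: "\<forall>n::nat. x n \<in> topspace X \<and> openin X (U n) \<and> x n \<in> U n"
      "\<forall>m n. m \<noteq> n \<longrightarrow> U m \<inter> U n = {}"
      using disjoint_open_sequence[OF X(2) regular(1) assms(2) order_refl] by (elim exE conjE)
    obtain y V where yV: "\<forall>n::nat. y n \<in> topspace Y \<and> openin Y (V n) \<and> y n \<in> V n"
      "\<forall>m n. m \<noteq> n \<longrightarrow> V m \<inter> V n = {}"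
      using disjoint_open_sequence[OF Y(2) regular(2) assms(4) order_refl] by (elim exE conjE)
    interpret pseudocompact_product X Y x U y V
      by unfold_locales (use X(1) Y(1) True xU yV in simp_all)
    show ?thesis
      by (rule conjI, rule disjI2, rule exI, rule quotient_Cp_c0_p,
          rule exI[of _ c0_p], rule exI[of _ functional])
        (simp add: quotient_Ck_c0_p_if_compact_finite[OF compact_finite] tvs_c0_p tvs_isomorphic_refl)
  next
    case False
    \<comment> \<open>Points are now drawn from \<open>K\<close> and \<open>L\<close>, while their
      disjoint neighbourhoods remain open in the full spaces.\<close>
    then obtain K L where KL: "compactin X K" "infinite K" "compactin Y L" "infinite L" by blast
    obtain x U where xU: "\<forall>n::nat. x n \<in> K \<and> openin X (U n) \<and> x n \<in> U n"
      "\<forall>m n. m \<noteq> n \<longrightarrow> U m \<inter> U n = {}"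
      using disjoint_open_sequence[OF X(2) regular(1) KL(2) compactin_subset_topspace[OF KL(1)]]
      by (elim exE conjE)
    obtain y V where yV: "\<forall>n::nat. y n \<in> L \<and> openin Y (V n) \<and> y n \<in> V n"
      "\<forall>m n. m \<noteq> n \<longrightarrow> V m \<inter> V n = {}"
      using disjoint_open_sequence[OF Y(2) regular(2) KL(4) compactin_subset_topspace[OF KL(3)]]
      by (elim exE conjE)
    interpret pseudocompact_product X Y x U y V
      by unfold_locales (use X(1) Y(1) True xU yV in simp_all)
    have c0: "tvs_quotient_map (Ck (prod_topology X Y)) c0 functional"
      by (rule quotient_Ck_c0_if_compact[OF KL(1,3) xU(1)[rule_format, THEN conjunct1]
            yV(1)[rule_format, THEN conjunct1]])
    show ?thesis
      by (rule conjI, rule disjI2, rule exI, rule quotient_Cp_c0_p,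
          rule exI[of _ c0], rule exI[of _ functional])
        (simp add: c0 tvs_c0 tvs_isomorphic_refl)
  qed
qed

end
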